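(* For every countable ordinal $\alpha$ there is a position in the variant of infinite draughts played with neither the forced-jump rule nor the forced-iterated-jump rule, whose game value, with Red as the open player, is exactly $\alpha$.
   Context: Infinite draughts is played by two players, Black and Red, on the infinite checkerboard $\mathbb{Z}\times\mathbb{Z}$, using only the dark squares (say those $(x,y)$ with $x+y$ even). A position consists of an arbitrary (possibly infinite) placement of pieces on dark squares, each piece being a black or red pawn or king, together with a specification of which player is to move. Black pawns move only on upward diagonals, red pawns only on downward diagonals; kings may move along all four diagonal directions. A simple move moves a piece one diagonal step, in a permitted direction, to an empty square. A jump moves a piece over a diagonally adjacent enemy piece (in a permitted direction) to the empty square immediately beyond; the jumped enemy piece is captured and removed. A single piece may perform several jumps in succession (an iterated jump), which together count as one turn. If a piece performs an infinite iterated jump, then all enemy pieces jumped are removed and the jumping piece itself is also removed from the board. There is no promotion of pawns. A player loses when it is their turn and they have no legal move; the other player then wins. Infinitely long play is a draw. In the variant considered here, jumping is never obligatory: a player may make any simple move or any (finite or infinite) jump sequence, stopping an iterated jump at any point. Game values (with respect to a designated "open" player, here Red) are defined by transfinite recursion: (1) a position in which the game is already won for the open player has value $0$; (2) if the game is not yet won and it is the open player's turn, and the open player can move to a position having a value, then the value is $\alpha+1$ where $\alpha$ is the least value of a position reachable in one legal move; (3) if it is the closed player's turn and every position reachable by a legal move has a value, then the value is the supremum of those values; otherwise the value is undefined. *)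

theory Defs
  imports Main "HOL-Library.Countable_Set"
begin

datatype colour = Black | Red
datatype kind = Pawn | King

type_synonym piece = "colour \<times> kind"
type_synonym square = "int \<times> int"
type_synonym board = "square \<Rightarrow> piece option"
type_synonym position = "board \<times> colour"

definition other :: "colour \<Rightarrow> colour" where
  "other c = (if c = Black then Red else Black)"

definition dark :: "square \<Rightarrow> bool" where
  "dark s \<longleftrightarrow> even (fst s + snd s)"

definition valid_pos :: "position \<Rightarrow> bool" where
  "valid_pos p \<longleftrightarrow> (\<forall>s. \<not> dark s \<longrightarrow> fst p s = None)"

definition sq_add :: "square \<Rightarrow> square \<Rightarrow> square" (infixl "\<oplus>" 65) where
  "s \<oplus> d = (fst s + fst d, snd s + snd d)"

definition diag_dirs :: "square set" where
  "diag_dirs = {(1,1), (1,-1), (-1,1), (-1,-1)}"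

definition allowed :: "piece \<Rightarrow> square \<Rightarrow> bool" where
  "allowed pc d \<longleftrightarrow> d \<in> diag_dirs \<and>
     (snd pc = King \<or> (fst pc = Black \<and> snd d = 1) \<or> (fst pc = Red \<and> snd d = -1))"

definition jump_ok :: "board \<Rightarrow> square \<Rightarrow> square \<Rightarrow> bool" where
  "jump_ok b s d \<longleftrightarrow> (\<exists>pc. b s = Some pc \<and> allowed pc d \<and>
      (\<exists>pc'. b (s \<oplus> d) = Some pc' \<and> fst pc' \<noteq> fst pc) \<and>
      b (s \<oplus> d \<oplus> d) = None)"

definition jump_res :: "board \<Rightarrow> square \<Rightarrow> square \<Rightarrow> board \<times> square" where
  "jump_res b s d = (b(s := None, s \<oplus> d := None, s \<oplus> d \<oplus> d := b s), s \<oplus> d \<oplus> d)"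

text \<open>Legal moves (no forced jumping): simple moves, finite iterated jumps
  (of any length \<ge> 1, stopping anywhere), and infinite iterated jumps, after which
  all jumped pieces and the jumping piece itself are removed.\<close>
definition move :: "position \<Rightarrow> position \<Rightarrow> bool" where
  "move p q \<longleftrightarrow> snd q = other (snd p) \<and>
    ((\<exists>s d pc. fst p s = Some pc \<and> fst pc = snd p \<and> allowed pc d \<and>
        fst p (s \<oplus> d) = None \<and> fst q = (fst p)(s := None, s \<oplus> d := Some pc))
   \<or> (\<exists>(bs :: nat \<Rightarrow> board) (ss :: nat \<Rightarrow> square) (ds :: nat \<Rightarrow> square) n.
        n \<ge> 1 \<and> bs 0 = fst p \<and> (\<exists>pc. fst p (ss 0) = Some pc \<and> fst pc = snd p) \<and>
        (\<forall>i<n. jump_ok (bs i) (ss i) (ds i) \<and>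
               (bs (Suc i), ss (Suc i)) = jump_res (bs i) (ss i) (ds i)) \<and>
        fst q = bs n)
   \<or> (\<exists>(bs :: nat \<Rightarrow> board) (ss :: nat \<Rightarrow> square) (ds :: nat \<Rightarrow> square).
        bs 0 = fst p \<and> (\<exists>pc. fst p (ss 0) = Some pc \<and> fst pc = snd p) \<and>
        (\<forall>i. jump_ok (bs i) (ss i) (ds i) \<and>
               (bs (Suc i), ss (Suc i)) = jump_res (bs i) (ss i) (ds i)) \<and>
        fst q = (\<lambda>x. if x = ss 0 \<or> (\<exists>i. x = ss i \<oplus> ds i) then None else fst p x)))"

text \<open>val_le p \<alpha>: position p has a game value and that value is \<le> \<alpha>.
  Ordinals are elements of an arbitrary well-ordered type 'o (every such type is
  order-isomorphic to an ordinal). A Black-to-move position with no move is won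
  for Red (value 0); at Black's turn the value is the supremum of the successors'
  values; at Red's turn it is (least successor value)+1.\<close>
inductive val_le :: "position \<Rightarrow> 'o::wellorder \<Rightarrow> bool" where
  closed: "snd p = Black \<Longrightarrow> (\<forall>q. move p q \<longrightarrow> val_le q \<alpha>) \<Longrightarrow> val_le p \<alpha>"
| open_: "snd p = Red \<Longrightarrow> move p q \<Longrightarrow> \<beta> < \<alpha> \<Longrightarrow> val_le q \<beta> \<Longrightarrow> val_le p \<alpha>"

definition has_value :: "position \<Rightarrow> 'o::wellorder \<Rightarrow> bool" where
  "has_value p \<alpha> \<longleftrightarrow> val_le p \<alpha> \<and> (\<forall>\<beta><\<alpha>. \<not> val_le p \<beta>)"

end

theory Submission
  imports Defs "HOL-Library.Nat_Bijection"
begin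

text \<open>
  Black has a single mobile piece, a pawn called the walker; nearly all other squares carry red
  pawns. In coordinates \<open>u, v\<close> along the two upward diagonals the walker moves by \<open>u + 1\<close> or
  \<open>v + 1\<close>, and red pawns move in the opposite directions. Empty squares two steps apart form lanes
  along which the walker jumps, arbitrarily far within one turn. If it stops on a lane, Red captures
  it through the square it has just cleared; if it never stops, it disappears. The exception is a
  gate: above a gate there is an empty entrance, and a walker that gets into it frees a black king
  that can then shuttle forever, so Red must spend the move on closing the door. Red hence
  never has a spare tempo to damage the lanes ahead.

  The lanes embed an infinitely branching well-founded tree: lines labelled by ordinals are
  drawn in the plane, and each gate leads from a line to a line with smaller label, every smaller
  label being reachable arbitrarily late. A walker resting at label \<open>\<alpha>\<close> survives for at least
  \<open>\<alpha>\<close>, while Red still wins. Since values cannot be skipped as Red wins, some position reached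
  on the way has value exactly \<open>\<alpha>\<close>.\<close>

declare split_paired_All [simp del] split_paired_Ex [simp del]

section \<open>General facts on play\<close>

text \<open>Red's win is stated without a rank, because the given type of ordinals may stop below
  the value of the positions considered.\<close>

inductive won :: "position \<Rightarrow> bool" where
  won_closed: "snd p = Black \<Longrightarrow> (\<And>q. move p q \<Longrightarrow> won q) \<Longrightarrow> won p"
| won_open: "snd p = Red \<Longrightarrow> move p q \<Longrightarrow> won q \<Longrightarrow> won p"

lemma val_le_mono: "val_le p \<alpha> \<Longrightarrow> \<alpha> \<le> \<beta> \<Longrightarrow> val_le p \<beta>"
proof (induction arbitrary: \<beta> rule: val_le.induct)
  case (closed p \<alpha>)
  then show ?case by (intro val_le.closed) auto
next
  case (open_ p q \<gamma> \<alpha>)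
  then show ?case by (intro val_le.open_[of p q \<gamma>]) auto
qed

abbreviation dirs_up :: "square set" where "dirs_up \<equiv> {(1,1), (-1,1)}"
abbreviation dirs_down :: "square set" where "dirs_down \<equiv> {(-1,-1), (1,-1)}"

lemma other_simps [simp]: "other Black = Red" "other Red = Black"
  by (simp_all add: other_def)

lemma val_le_RedE:
  assumes "val_le (b, Red) \<gamma>"
  obtains b' \<beta> where "move (b, Red) (b', Black)" "\<beta> < \<gamma>" "val_le (b', Black) \<beta>"
  using assms
proof (cases rule: val_le.cases)
  case (open_ q \<beta>)
  moreover have "snd q = Black" using open_(2) by (simp add: move_def)
  ultimately show ?thesis using that[of "fst q" \<beta>] by (metis prod.collapse)
qed simp

lemma val_le_BlackD: "val_le (b, Black) \<gamma> \<Longrightarrow> move (b, Black) q \<Longrightarrow> val_le q \<gamma>"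
  by (cases rule: val_le.cases) auto

lemma allowed_simps [simp]:
  "allowed (Black, Pawn) d \<longleftrightarrow> d \<in> dirs_up"
  "allowed (Red, Pawn) d \<longleftrightarrow> d \<in> dirs_down"
  "allowed (c, King) d \<longleftrightarrow> d \<in> diag_dirs"
  by (auto simp: allowed_def diag_dirs_def)

lemma allowed_diag: "allowed pc d \<Longrightarrow> d \<in> diag_dirs"
  by (simp add: allowed_def)

lemma sq_add_simps [simp]: "(s \<oplus> d = s \<oplus> e) = (d = e)" "(s \<oplus> d = s) = (d = (0,0))"
  "(s = s \<oplus> d) = (d = (0,0))"
  by (cases s; cases d; cases e; auto simp: sq_add_def)+

lemma dark_sq_add: "d \<in> diag_dirs \<Longrightarrow> dark (s \<oplus> d) = dark s"
  by (auto simp: diag_dirs_def dark_def sq_add_def)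

section \<open>Moves and iterated jumps\<close>

lemma move_cases [consumes 1, case_names simple jumps infinite]:
  assumes "move (b, c) (b', c')"
  obtains (simple) s d k where "b s = Some (c, k)" "allowed (c, k) d" "b (s \<oplus> d) = None"
      "b' = b(s := None, s \<oplus> d := Some (c, k))" "c' = other c"
  | (jumps) bs ss ds n k where "n \<ge> 1" "bs 0 = b" "b (ss 0) = Some (c, k)"
      "\<And>i. i < n \<Longrightarrow> jump_ok (bs i) (ss i) (ds i)"
      "\<And>i. i < n \<Longrightarrow> (bs (Suc i), ss (Suc i)) = jump_res (bs i) (ss i) (ds i)"
      "b' = bs n" "c' = other c"
  | (infinite) bs ss ds k where "bs 0 = b" "b (ss 0) = Some (c, k)"
      "\<And>i. jump_ok (bs i) (ss i) (ds i)"
      "\<And>i. (bs (Suc i), ss (Suc i)) = jump_res (bs i) (ss i) (ds i)"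
      "b' = (\<lambda>x. if x = ss 0 \<or> (\<exists>i. x = ss i \<oplus> ds i) then None else b x)" "c' = other c"
proof -
  have c': "c' = other c" using assms by (simp add: move_def)
  consider (a) "\<exists>s d pc. b s = Some pc \<and> fst pc = c \<and> allowed pc d \<and>
        b (s \<oplus> d) = None \<and> b' = b(s := None, s \<oplus> d := Some pc)"
    | (b) "\<exists>(bs :: nat \<Rightarrow> board) (ss :: nat \<Rightarrow> square) (ds :: nat \<Rightarrow> square) n.
        n \<ge> 1 \<and> bs 0 = b \<and> (\<exists>pc. b (ss 0) = Some pc \<and> fst pc = c) \<and>
        (\<forall>i<n. jump_ok (bs i) (ss i) (ds i) \<and>
               (bs (Suc i), ss (Suc i)) = jump_res (bs i) (ss i) (ds i)) \<and>
        b' = bs n"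
    | (c) "\<exists>(bs :: nat \<Rightarrow> board) (ss :: nat \<Rightarrow> square) (ds :: nat \<Rightarrow> square).
        bs 0 = b \<and> (\<exists>pc. b (ss 0) = Some pc \<and> fst pc = c) \<and>
        (\<forall>i. jump_ok (bs i) (ss i) (ds i) \<and>
               (bs (Suc i), ss (Suc i)) = jump_res (bs i) (ss i) (ds i)) \<and>
        b' = (\<lambda>x. if x = ss 0 \<or> (\<exists>i. x = ss i \<oplus> ds i) then None else b x)"
    using assms unfolding move_def fst_conv snd_conv by (elim conjE disjE) simp_all
  then show ?thesis
  proof cases
    case a
    then obtain s d pc where "b s = Some pc" "fst pc = c" "allowed pc d"
        "b (s \<oplus> d) = None" "b' = b(s := None, s \<oplus> d := Some pc)" by blast
    then show ?thesis using simple[of s "snd pc" d] c' by (cases pc) auto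
  next
    case b
    then obtain bs ss ds n pc where "n \<ge> 1" "bs 0 = b" "b (ss 0) = Some pc" "fst pc = c"
        "\<forall>i<n. jump_ok (bs i) (ss i) (ds i) \<and>
               (bs (Suc i), ss (Suc i)) = jump_res (bs i) (ss i) (ds i)"
        "b' = bs n" by blast
    then show ?thesis using jumps[of n bs ss "snd pc" ds] c' by (cases pc) auto
  next
    case c
    then obtain bs ss ds pc where "bs 0 = b" "b (ss 0) = Some pc" "fst pc = c"
        "\<forall>i. jump_ok (bs i) (ss i) (ds i) \<and>
               (bs (Suc i), ss (Suc i)) = jump_res (bs i) (ss i) (ds i)"
        "b' = (\<lambda>x. if x = ss 0 \<or> (\<exists>i. x = ss i \<oplus> ds i) then None else b x)" by blast
    then show ?thesis using infinite[of bs ss "snd pc" ds] c' by (cases pc) auto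
  qed
qed

lemma move_simple:
  assumes "b s = Some (c, k)" "allowed (c, k) d" "b (s \<oplus> d) = None"
  shows "move (b, c) (b(s := None, s \<oplus> d := Some (c, k)), other c)"
  unfolding move_def using assms by (intro conjI disjI1 exI[of _ s] exI[of _ d] exI[of _ "(c, k)"]) auto

text \<open>Finite iterated jumps built one jump at a time, so that concrete ones compose without
  naming sequences of boards.\<close>

inductive jump_seq :: "board \<times> square \<Rightarrow> board \<times> square \<Rightarrow> bool" where
  jump_one: "jump_ok b s d \<Longrightarrow> jump_seq (b, s) (jump_res b s d)"
| jump_snoc: "jump_seq p (b, s) \<Longrightarrow> jump_ok b s d \<Longrightarrow> jump_seq p (jump_res b s d)"

lemma jump_seq_unfold:
  assumes "jump_seq p r"
  shows "\<exists>(bs :: nat \<Rightarrow> board) ss ds n. n \<ge> 1 \<and> bs 0 = fst p \<and> ss 0 = snd p \<and>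
    (\<forall>i<n. jump_ok (bs i) (ss i) (ds i) \<and>
           (bs (Suc i), ss (Suc i)) = jump_res (bs i) (ss i) (ds i)) \<and> r = (bs n, ss n)"
  using assms
proof (induction rule: jump_seq.induct)
  case (jump_one b s d)
  show ?case
    by (rule exI[of _ "\<lambda>i. if i = 0 then b else fst (jump_res b s d)"],
        rule exI[of _ "\<lambda>i. if i = 0 then s else snd (jump_res b s d)"],
        rule exI[of _ "\<lambda>_. d"], rule exI[of _ 1]) (use jump_one in simp)
next
  case (jump_snoc p b s d)
  then obtain bs ss ds n where *: "n \<ge> 1" "bs 0 = fst p" "ss 0 = snd p"
     "\<forall>i<n. jump_ok (bs i) (ss i) (ds i) \<and>
           (bs (Suc i), ss (Suc i)) = jump_res (bs i) (ss i) (ds i)" "(b, s) = (bs n, ss n)"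
    by blast
  show ?case
    by (rule exI[of _ "bs(Suc n := fst (jump_res b s d))"],
        rule exI[of _ "ss(Suc n := snd (jump_res b s d))"],
        rule exI[of _ "ds(n := d)"], rule exI[of _ "Suc n"])
       (use * jump_snoc(2) in \<open>auto simp: less_Suc_eq\<close>)
qed

lemma move_jump_seq:
  assumes "jump_seq (b, s) (b', s')" "b s = Some (c, k)"
  shows "move (b, c) (b', other c)"
proof -
  obtain bs ss ds n where "n \<ge> 1" "bs 0 = b" "ss 0 = s"
     "\<forall>i<n. jump_ok (bs i) (ss i) (ds i) \<and>
           (bs (Suc i), ss (Suc i)) = jump_res (bs i) (ss i) (ds i)" "b' = bs n"
    using jump_seq_unfold[OF assms(1)] by auto
  then have "\<exists>(bs :: nat \<Rightarrow> board) (ss :: nat \<Rightarrow> square) (ds :: nat \<Rightarrow> square) n.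
        n \<ge> 1 \<and> bs 0 = b \<and> (\<exists>pc. b (ss 0) = Some pc \<and> fst pc = c) \<and>
        (\<forall>i<n. jump_ok (bs i) (ss i) (ds i) \<and>
               (bs (Suc i), ss (Suc i)) = jump_res (bs i) (ss i) (ds i)) \<and>
        b' = bs n"
    using assms(2) by (intro exI[of _ bs] exI[of _ ss] exI[of _ ds] exI[of _ n]) simp
  then show ?thesis unfolding move_def fst_conv snd_conv by (intro conjI disjI2 disjI1) simp_all
qed

lemma jump_ok_dir: "jump_ok b s d \<Longrightarrow> d \<in> diag_dirs"
  by (auto simp: jump_ok_def allowed_def)

lemma valid_jump_res:
  assumes "\<forall>s. \<not> dark s \<longrightarrow> b s = None" "jump_ok b s d" "(b', s') = jump_res b s d"
  shows "\<forall>s. \<not> dark s \<longrightarrow> b' s = None"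
proof -
  have "d \<in> diag_dirs" using assms(2) by (rule jump_ok_dir)
  moreover have "dark s" using assms(1,2) by (auto simp: jump_ok_def)
  ultimately show ?thesis using assms(1,3) by (auto simp: jump_res_def dark_sq_add)
qed

lemma valid_pos_move:
  assumes "valid_pos p" "move p q"
  shows "valid_pos q"
proof -
  obtain b c b' c' where pq: "p = (b, c)" "q = (b', c')" by (metis surj_pair)
  have v: "\<forall>s. \<not> dark s \<longrightarrow> b s = None" using assms(1) by (simp add: valid_pos_def pq)
  have "\<forall>s. \<not> dark s \<longrightarrow> b' s = None"
    using assms(2) unfolding pq
  proof (cases rule: move_cases)
    case (simple s d k)
    then have "dark s" "d \<in> diag_dirs" using v by (auto dest: allowed_diag)
    then have "dark (s \<oplus> d)" by (simp add: dark_sq_add)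
    then show ?thesis using v simple by auto
  next
    case (jumps bs ss ds n k)
    have "i \<le> n \<Longrightarrow> \<forall>s. \<not> dark s \<longrightarrow> bs i s = None" for i
    proof (induction i)
      case (Suc i)
      then show ?case using valid_jump_res[of "bs i", OF _ jumps(4,5)[of i]] by auto
    qed (use v jumps in auto)
    then show ?thesis using jumps by auto
  next
    case (infinite bs ss ds k)
    then show ?thesis using v by auto
  qed
  then show ?thesis by (simp add: valid_pos_def pq)
qed

text \<open>Walking down a winning strategy, the value cannot skip an ordinal.\<close>
lemma won_attains:
  fixes \<alpha> :: "'o::wellorder"
  assumes "won p" "valid_pos p" "\<forall>\<beta><\<alpha>. \<not> val_le p \<beta>"
  shows "\<exists>q. valid_pos q \<and> has_value q \<alpha>"
  using assms
proof (induction rule: won.induct)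
  case (won_closed p)
  show ?case
  proof (cases "val_le p \<alpha>")
    case True
    then show ?thesis using won_closed.prems by (auto simp: has_value_def)
  next
    case False
    then obtain q where q: "move p q" "\<not> val_le q \<alpha>"
      using won_closed.hyps val_le.closed by blast
    then have "\<forall>\<beta><\<alpha>. \<not> val_le q \<beta>" by (meson less_imp_le val_le_mono)
    then show ?thesis using won_closed q valid_pos_move by blast
  qed
next
  case (won_open p q)
  show ?case
  proof (cases "val_le p \<alpha>")
    case True
    then show ?thesis using won_open.prems by (auto simp: has_value_def)
  next
    case False
    then have "\<forall>\<beta><\<alpha>. \<not> val_le q \<beta>" using won_open.hyps val_le.open_ by blast
    then show ?thesis using won_open valid_pos_move by blast
  qed
qed

section \<open>Squares that red jumps cannot touch\<close>

abbreviation black_at :: "board \<Rightarrow> square \<Rightarrow> bool" where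
  "black_at b s \<equiv> (\<exists>k. b s = Some (Black, k))"
abbreviation red_at :: "board \<Rightarrow> square \<Rightarrow> bool" where
  "red_at b s \<equiv> (\<exists>k. b s = Some (Red, k))"

abbreviation opposite :: "square \<Rightarrow> square" where "opposite d \<equiv> (- fst d, - snd d)"

definition red_pawns :: "board \<Rightarrow> bool" where
  "red_pawns b \<longleftrightarrow> (\<forall>s k. b s = Some (Red, k) \<longrightarrow> k = Pawn)"

text \<open>No red jump can start in, capture in, or land in \<open>F\<close>; the condition is so stated that it
  survives such a jump, which makes it applicable to iterated jumps.\<close>
definition guarded :: "board \<Rightarrow> square set \<Rightarrow> bool" where
  "guarded b F \<longleftrightarrow> (\<forall>s\<in>F. \<forall>d\<in>dirs_up.
     (b s = None \<longrightarrow> \<not> black_at b (s \<oplus> d) \<or> s \<oplus> d \<in> F) \<and>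
     (black_at b s \<longrightarrow> s \<oplus> d \<in> F \<and> \<not> red_at b (s \<oplus> d) \<or>
        s \<oplus> opposite d \<in> F \<and> b (s \<oplus> opposite d) \<noteq> None) \<and>
     (red_at b s \<longrightarrow> \<not> black_at b (s \<oplus> opposite d) \<or>
        s \<oplus> opposite d \<oplus> opposite d \<in> F \<and> b (s \<oplus> opposite d \<oplus> opposite d) \<noteq> None))"

lemma not_red: "fst pc \<noteq> Red \<Longrightarrow> \<exists>k. pc = (Black, k)"
  by (cases pc; cases "fst pc") auto

text \<open>Red pawns jump downwards only. The clauses of \<open>guarded\<close> for red, black and
  empty squares exclude origin, captured piece and landing square in turn; the last one only puts
  the captured piece into \<open>F\<close>, whence the second clause applies.\<close>

lemma red_jump_avoids:
  assumes g: "guarded b F" and rp: "red_pawns b" and r: "red_at b s" and j: "jump_ok b s d"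
  shows "s \<notin> F" "s \<oplus> d \<notin> F" "s \<oplus> d \<oplus> d \<notin> F"
proof -
  obtain k where k: "b s = Some (Red, k)" using r by blast
  then have "k = Pawn" using rp by (simp add: red_pawns_def)
  with k j have d: "d \<in> dirs_down" and m: "black_at b (s \<oplus> d)" and t: "b (s \<oplus> d \<oplus> d) = None"
    by (auto simp: jump_ok_def dest: not_red)
  define e where "e = opposite d"
  have e: "e \<in> dirs_up" "opposite e = d" using d by (auto simp: e_def)
  have undo: "s \<oplus> d \<oplus> e = s" "s \<oplus> d \<oplus> d \<oplus> e = s \<oplus> d"
    by (simp_all add: sq_add_def e_def)
  have G: "(b x = None \<longrightarrow> \<not> black_at b (x \<oplus> e) \<or> x \<oplus> e \<in> F) \<and>
     (black_at b x \<longrightarrow> x \<oplus> e \<in> F \<and> \<not> red_at b (x \<oplus> e) \<or> x \<oplus> d \<in> F \<and> b (x \<oplus> d) \<noteq> None) \<and>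
     (red_at b x \<longrightarrow> \<not> black_at b (x \<oplus> d) \<or> x \<oplus> d \<oplus> d \<in> F \<and> b (x \<oplus> d \<oplus> d) \<noteq> None)"
    if "x \<in> F" for x
    using bspec[OF bspec[OF g[unfolded guarded_def] that] e(1)] unfolding e(2) .
  show "s \<notin> F" using G[of s] r m t by blast
  show 2: "s \<oplus> d \<notin> F" using G[of "s \<oplus> d"] r m t unfolding undo by blast
  show "s \<oplus> d \<oplus> d \<notin> F" using G[of "s \<oplus> d \<oplus> d"] m t 2 unfolding undo by blast
qed

text \<open>Occupancy is demanded only of squares in \<open>F\<close>; outside \<open>F\<close> only
  the absence of black pieces counts, and captures by Red preserve that.\<close>

lemma guarded_cong:
  assumes "guarded b F" "\<And>s. s \<in> F \<Longrightarrow> b' s = b s" "\<And>s. black_at b' s \<Longrightarrow> black_at b s"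
  shows "guarded b' F"
  unfolding guarded_def
proof (intro ballI conjI impI)
  fix s d assume sd: "s \<in> F" "d \<in> dirs_up"
  have eq: "b' s = b s" using assms(2) sd by blast
  note g = bspec[OF bspec[OF assms(1)[unfolded guarded_def] sd(1)] sd(2)]
  show "\<not> black_at b' (s \<oplus> d) \<or> s \<oplus> d \<in> F" if "b' s = None"
    using g[THEN conjunct1] that assms(3) unfolding eq by blast
  show "s \<oplus> d \<in> F \<and> \<not> red_at b' (s \<oplus> d) \<or>
        s \<oplus> opposite d \<in> F \<and> b' (s \<oplus> opposite d) \<noteq> None" if "black_at b' s"
    using g[THEN conjunct2, THEN conjunct1, rule_format, OF that[unfolded eq]]
    by (elim disjE conjE) (simp_all add: assms(2))
  show "\<not> black_at b' (s \<oplus> opposite d) \<or>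
        s \<oplus> opposite d \<oplus> opposite d \<in> F \<and> b' (s \<oplus> opposite d \<oplus> opposite d) \<noteq> None"
    if "red_at b' s"
    using g[THEN conjunct2, THEN conjunct2, rule_format, OF that[unfolded eq]]
  proof
    assume "\<not> black_at b (s \<oplus> opposite d)"
    then show ?thesis using assms(3) by blast
  next
    assume "s \<oplus> opposite d \<oplus> opposite d \<in> F \<and> b (s \<oplus> opposite d \<oplus> opposite d) \<noteq> None"
    then show ?thesis by (simp add: assms(2))
  qed
qed

lemma red_jumps_keep:
  assumes g: "guarded b F" and rp: "red_pawns b" and r: "red_at b (ss 0)" and "bs 0 = b"
    and j: "\<And>i. i < n \<Longrightarrow> jump_ok (bs i) (ss i) (ds i)"
    and e: "\<And>i. i < n \<Longrightarrow> (bs (Suc i), ss (Suc i)) = jump_res (bs i) (ss i) (ds i)"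
  shows "i \<le> n \<Longrightarrow> guarded (bs i) F \<and> red_pawns (bs i) \<and> red_at (bs i) (ss i) \<and>
    (\<forall>s\<in>F. bs i s = b s) \<and> (\<forall>s. black_at (bs i) s \<longrightarrow> black_at b s)"
proof (induction i)
  case 0
  then show ?case using assms by auto
next
  case (Suc i)
  then have IH: "guarded (bs i) F" "red_pawns (bs i)" "red_at (bs i) (ss i)"
    "\<forall>s\<in>F. bs i s = b s" "\<forall>s. black_at (bs i) s \<longrightarrow> black_at b s" and i: "i < n" by auto
  note av = red_jump_avoids[OF IH(1,2,3) j[OF i]]
  have b1: "bs (Suc i) = (bs i)(ss i := None, ss i \<oplus> ds i := None, ss i \<oplus> ds i \<oplus> ds i := bs i (ss i))"
    and s1: "ss (Suc i) = ss i \<oplus> ds i \<oplus> ds i" using e[OF i] by (auto simp: jump_res_def)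
  have keep: "\<forall>s\<in>F. bs (Suc i) s = bs i s" using av by (auto simp: b1)
  have bl: "\<forall>s. black_at (bs (Suc i)) s \<longrightarrow> black_at (bs i) s" using IH(3) by (auto simp: b1)
  have "guarded (bs (Suc i)) F" using guarded_cong[OF IH(1), of "bs (Suc i)"] keep bl by blast
  moreover have "red_pawns (bs (Suc i))"
    unfolding red_pawns_def
  proof (intro allI impI)
    fix s k assume "bs (Suc i) s = Some (Red, k)"
    then have "bs i s = Some (Red, k) \<or> bs i (ss i) = Some (Red, k)"
      by (auto simp: b1 split: if_splits)
    then show "k = Pawn" using IH(2) by (auto simp: red_pawns_def)
  qed
  moreover have "red_at (bs (Suc i)) (ss (Suc i))" using IH(3) by (simp add: b1 s1)
  moreover have "\<forall>s\<in>F. bs (Suc i) s = b s" using keep IH(4) by simp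
  moreover have "\<forall>s. black_at (bs (Suc i)) s \<longrightarrow> black_at b s" using bl IH(5) by blast
  ultimately show ?case by blast
qed

text \<open>Being guarded controls jumps only, so simple moves remain as an explicit alternative, to
  be checked against the concrete squares of each gadget.\<close>

lemma red_move:
  assumes g: "guarded b F" and rp: "red_pawns b" and m: "move (b, Red) (b', c)"
  shows "c = Black" "red_pawns b'" "black_at b' s \<Longrightarrow> black_at b s"
    "(\<forall>s\<in>F. b' s = b s) \<or> (\<exists>s d. d \<in> dirs_down \<and> b s = Some (Red, Pawn) \<and> b (s \<oplus> d) = None \<and>
        b' = b(s := None, s \<oplus> d := Some (Red, Pawn)))"
proof -
  have "c = Black \<and> red_pawns b' \<and> (\<forall>s. black_at b' s \<longrightarrow> black_at b s) \<and>
    ((\<forall>s\<in>F. b' s = b s) \<or> (\<exists>s d. d \<in> dirs_down \<and> b s = Some (Red, Pawn) \<and> b (s \<oplus> d) = None \<and>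
        b' = b(s := None, s \<oplus> d := Some (Red, Pawn))))"
    using m
  proof (cases rule: move_cases)
    case (simple s d k)
    then have "k = Pawn" using rp by (simp add: red_pawns_def)
    with simple have "d \<in> dirs_down" by simp
    then have "\<exists>s d. d \<in> dirs_down \<and> b s = Some (Red, Pawn) \<and> b (s \<oplus> d) = None \<and>
        b' = b(s := None, s \<oplus> d := Some (Red, Pawn))"
      using simple \<open>k = Pawn\<close> by blast
    then show ?thesis using simple rp by (auto simp: red_pawns_def split: if_splits)
  next
    case (jumps bs ss ds n k)
    then show ?thesis using red_jumps_keep[OF g rp, of ss bs n ds n] by auto
  next
    case (infinite bs ss ds k)
    \<comment> \<open>Every finite prefix of the jump avoids \<open>F\<close>, hence so do all
      squares that are emptied at the end.\<close>
    have *: "guarded (bs i) F \<and> red_pawns (bs i) \<and> red_at (bs i) (ss i)" for i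
      using red_jumps_keep[OF g rp, of ss bs i ds i] infinite by auto
    then have "ss i \<notin> F" "ss i \<oplus> ds i \<notin> F" for i
      using red_jump_avoids infinite(3) by blast+
    then show ?thesis using infinite rp by (auto simp: red_pawns_def)
  qed
  then show "c = Black" "red_pawns b'" "black_at b' s \<Longrightarrow> black_at b s"
    "(\<forall>s\<in>F. b' s = b s) \<or> (\<exists>s d. d \<in> dirs_down \<and> b s = Some (Red, Pawn) \<and> b (s \<oplus> d) = None \<and>
        b' = b(s := None, s \<oplus> d := Some (Red, Pawn)))" by auto
qed

section \<open>The gadget\<close>

text \<open>The square with coordinates \<open>u = 16 x + i\<close> and \<open>v = 16 y + 2 x + j\<close>, where \<open>(x, y)\<close> is a cell and
  \<open>(i, j)\<close> a place inside it. The shear \<open>2 x\<close> is there because a rightward lane climbs by two at its gate.\<close>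
definition loc :: "int \<Rightarrow> int \<Rightarrow> int \<Rightarrow> int \<Rightarrow> square" where
  "loc x y i j = (14 * x - 16 * y + i - j, 18 * x + 16 * y + i + j)"

lemma loc_add [simp]:
  "loc x y i j \<oplus> (1, 1) = loc x y (i + 1) j"
  "loc x y i j \<oplus> (-1, 1) = loc x y i (j + 1)"
  "loc x y i j \<oplus> (-1, -1) = loc x y (i - 1) j"
  "loc x y i j \<oplus> (1, -1) = loc x y i (j - 1)"
  by (simp_all add: loc_def sq_add_def)

lemma loc_eq_iff [simp]: "loc x y i j = loc x y i' j' \<longleftrightarrow> i = i' \<and> j = j'"
  by (auto simp: loc_def)

lemma add_eq_loc:
  "s \<oplus> (-1, -1) = loc x y i j \<longleftrightarrow> s = loc x y (i + 1) j"
  "s \<oplus> (1, -1) = loc x y i j \<longleftrightarrow> s = loc x y i (j + 1)"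
  by (cases s; auto simp: loc_def sq_add_def)+

text \<open>Two layers around the king, the outer one protecting the inner one from captures.
  \<open>(7,3)\<close> and \<open>(8,3)\<close> keep Red out of \<open>(6,3)\<close>, the landing
  square between the two jumps that start at the entrance.\<close>

abbreviation wall_squares :: "(int \<times> int) set" where
  "wall_squares \<equiv> {(7,3), (8,3), (8,4), (9,4), (7,5), (8,5), (9,5), (6,6), (7,6), (6,7), (7,7)}"

text \<open>The black king of a gadget shuttles between two squares that no red piece can ever enter.\<close>
definition released :: "int \<Rightarrow> int \<Rightarrow> board \<Rightarrow> bool" where
  "released x y b \<longleftrightarrow> red_pawns b \<and> (\<forall>(i, j) \<in> wall_squares - {(7,3), (8,3)}. black_at b (loc x y i j)) \<and>
     \<not> red_at b (loc x y 6 5) \<and>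
     (b (loc x y 6 4) = None \<and> b (loc x y 7 4) = Some (Black, King) \<or>
      b (loc x y 6 4) = Some (Black, King) \<and> b (loc x y 7 4) = None)"

text \<open>The squares above \<open>(7,4)\<close> and \<open>(6,5)\<close> are black wall pawns,
  and those above \<open>(6,4)\<close> are \<open>(7,4)\<close> and \<open>(6,5)\<close> themselves,
  so no red pawn can step into the shuttle. The thickness of the wall rules out jumps.\<close>

lemma released_red:
  assumes r: "released x y b" and m: "move (b, Red) (b', c)"
  shows "released x y b'"
proof -
  define F where "F = {loc x y 8 4, loc x y 9 4, loc x y 7 5, loc x y 8 5, loc x y 9 5, loc x y 6 6,
     loc x y 7 6, loc x y 6 7, loc x y 7 7, loc x y 6 4, loc x y 7 4, loc x y 6 5}"
  have rp: "red_pawns b" using r by (simp add: released_def)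
  have bl: "black_at b (loc x y 8 4)" "black_at b (loc x y 9 4)" "black_at b (loc x y 7 5)"
    "black_at b (loc x y 8 5)" "black_at b (loc x y 9 5)" "black_at b (loc x y 6 6)"
    "black_at b (loc x y 7 6)" "black_at b (loc x y 6 7)" "black_at b (loc x y 7 7)"
    and y2: "\<not> red_at b (loc x y 6 5)"
    and k: "b (loc x y 6 4) = None \<and> b (loc x y 7 4) = Some (Black, King) \<or>
      b (loc x y 6 4) = Some (Black, King) \<and> b (loc x y 7 4) = None"
    using r by (auto simp: released_def)
  have g: "guarded b F"
    unfolding guarded_def F_def using bl y2 k by (auto; fastforce?)
  have y2': "b (loc x y 6 5) = None \<or> black_at b (loc x y 6 5)"
    using y2 by (metis not_None_eq surj_pair colour.exhaust)
  have keep: "\<forall>s\<in>F. b' s = b s"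
    using red_move(4)[OF g rp m]
  proof
    assume "\<exists>s d. d \<in> dirs_down \<and> b s = Some (Red, Pawn) \<and> b (s \<oplus> d) = None \<and>
        b' = b(s := None, s \<oplus> d := Some (Red, Pawn))"
    then obtain s d where sd: "d \<in> dirs_down" "b s = Some (Red, Pawn)" "b (s \<oplus> d) = None"
        "b' = b(s := None, s \<oplus> d := Some (Red, Pawn))" by blast
    have "s \<notin> F" using sd(2) bl y2' k unfolding F_def by auto
    moreover have "s \<oplus> d \<notin> F" using sd(1,2,3) bl y2' k unfolding F_def by (auto simp: add_eq_loc)
    ultimately show ?thesis using sd(4) by auto
  qed
  then have "b' (loc x y i j) = b (loc x y i j)" if "(i, j) \<in> {(8,4), (9,4), (7,5), (8,5), (9,5),
      (6,6), (7,6), (6,7), (7,7), (6,4), (7,4), (6,5)}" for i j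
    using that by (auto simp: F_def)
  then show ?thesis using red_move(2)[OF g rp m] bl y2 k by (auto simp: released_def)
qed

lemma released_black:
  assumes "released x y b"
  shows "\<exists>b'. move (b, Black) (b', Red) \<and> released x y b'"
proof -
  have k: "b (loc x y 6 4) = None \<and> b (loc x y 7 4) = Some (Black, King) \<or>
      b (loc x y 6 4) = Some (Black, King) \<and> b (loc x y 7 4) = None"
    using assms by (simp add: released_def)
  then show ?thesis
  proof
    assume *: "b (loc x y 6 4) = None \<and> b (loc x y 7 4) = Some (Black, King)"
    have "move (b, Black) (b(loc x y 7 4 := None, loc x y 6 4 := Some (Black, King)), Red)"
      using move_simple[of b "loc x y 7 4" Black King "(-1,-1)"] * by (simp add: diag_dirs_def)
    moreover have "released x y (b(loc x y 7 4 := None, loc x y 6 4 := Some (Black, King)))"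
      using assms by (auto simp: released_def red_pawns_def)
    ultimately show ?thesis by blast
  next
    assume *: "b (loc x y 6 4) = Some (Black, King) \<and> b (loc x y 7 4) = None"
    have "move (b, Black) (b(loc x y 6 4 := None, loc x y 7 4 := Some (Black, King)), Red)"
      using move_simple[of b "loc x y 6 4" Black King "(1,1)"] * by (simp add: diag_dirs_def)
    moreover have "released x y (b(loc x y 6 4 := None, loc x y 7 4 := Some (Black, King)))"
      using assms by (auto simp: released_def red_pawns_def)
    ultimately show ?thesis by blast
  qed
qed

text \<open>Black always has a shuttle move and Red cannot stop it, so Black never runs out of
  moves.\<close>

lemma released_no_value: "val_le p \<gamma> \<Longrightarrow> \<not> released x y (fst p)"
proof (induction rule: val_le.induct)
  case (closed p \<gamma>)
  show ?case
  proof
    assume "released x y (fst p)"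
    then obtain b' where "move (fst p, Black) (b', Red)" "released x y b'"
      using released_black by blast
    then show False using closed by (metis fst_conv prod.collapse)
  qed
next
  case (open_ p q \<beta> \<alpha>)
  then show ?case using released_red by (metis prod.collapse)
qed

section \<open>The gadget before the release, and its entrance\<close>

definition armed :: "int \<Rightarrow> int \<Rightarrow> board \<Rightarrow> bool" where
  "armed x y b \<longleftrightarrow> red_pawns b \<and> (\<forall>(i, j) \<in> wall_squares. black_at b (loc x y i j)) \<and>
     b (loc x y 7 4) = Some (Black, King) \<and>
     b (loc x y 5 3) = Some (Red, Pawn) \<and> b (loc x y 6 4) = Some (Red, Pawn) \<and>
     b (loc x y 6 3) = None \<and> b (loc x y 6 5) = None"

text \<open>What makes a walker on \<open>(4,3)\<close> safe. \<open>(3,3)\<close> blocks the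
  capture by the door pawn and \<open>(5,2)\<close> blocks its step aside; from the empty
  \<open>(4,4)\<close> nothing can capture. The four squares without black pieces deny Red a jump
  that vacates \<open>(3,3)\<close> or lands on \<open>(4,4)\<close>.\<close>

definition sealed :: "int \<Rightarrow> int \<Rightarrow> board \<Rightarrow> bool" where
  "sealed x y b \<longleftrightarrow>
     b (loc x y 4 4) = None \<and> b (loc x y 3 3) = Some (Red, Pawn) \<and> b (loc x y 5 2) = Some (Red, Pawn) \<and>
     (\<forall>(i, j) \<in> {(5,4), (4,5), (2,3), (3,2)}. \<not> black_at b (loc x y i j))"

lemma released_vacate:
  assumes "armed x y b" "b (loc x y 6 4 \<oplus> d) = None" "d \<in> dirs_down"
  shows "released x y (b(loc x y 6 4 := None, loc x y 6 4 \<oplus> d := Some (Red, Pawn)))"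
  using assms by (auto simp: armed_def released_def red_pawns_def)

lemma double_jump:
  assumes a: "armed x y b" and w: "b (loc x y 4 3) = Some (Black, Pawn)"
  shows "\<exists>b'. move (b, Black) (b', Red) \<and> released x y b'"
proof -
  have c: "b (loc x y 5 3) = Some (Red, Pawn)" "b (loc x y 6 4) = Some (Red, Pawn)"
     "b (loc x y 6 3) = None" "b (loc x y 6 5) = None"
    using a by (auto simp: armed_def)
  define b1 where "b1 = b(loc x y 4 3 := None, loc x y 5 3 := None, loc x y 6 3 := Some (Black, Pawn))"
  define b2 where "b2 = b1(loc x y 6 3 := None, loc x y 6 4 := None, loc x y 6 5 := Some (Black, Pawn))"
  have j1: "jump_ok b (loc x y 4 3) (1,1)" "jump_res b (loc x y 4 3) (1,1) = (b1, loc x y 6 3)"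
    using w c by (simp_all add: jump_ok_def jump_res_def b1_def)
  have j2: "jump_ok b1 (loc x y 6 3) (-1,1)" "jump_res b1 (loc x y 6 3) (-1,1) = (b2, loc x y 6 5)"
    using w c by (simp_all add: jump_ok_def jump_res_def b1_def b2_def)
  have "jump_seq (b, loc x y 4 3) (b2, loc x y 6 5)"
    using jump_snoc[OF _ j2(1)] jump_one[OF j1(1)] j1(2) j2(2) by metis
  then have "move (b, Black) (b2, Red)" using move_jump_seq w other_simps by metis
  moreover have "released x y b2"
    using a by (auto simp: b2_def b1_def armed_def released_def red_pawns_def)
  ultimately show ?thesis by blast
qed

text \<open>Red can neither capture the walker nor move the door pawn nor fill \<open>(6,3)\<close>
  or \<open>(6,5)\<close> from outside. Moving the pawn on \<open>(6,4)\<close> frees the king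
  directly; anything else allows the double jump.\<close>

lemma entered_no_value:
  assumes a: "armed x y b" and f: "sealed x y b" and w: "b (loc x y 4 3) = Some (Black, Pawn)"
  shows "\<not> val_le (b, Red) \<gamma>"
proof
  assume "val_le (b, Red) \<gamma>"
  then obtain b' \<beta> where m: "move (b, Red) (b', Black)" and v: "val_le (b', Black) \<beta>" and "\<beta> < \<gamma>"
    by (rule val_le_RedE)
  define F where "F = {loc x y 7 3, loc x y 8 3, loc x y 8 4, loc x y 9 4, loc x y 7 5, loc x y 8 5,
     loc x y 9 5, loc x y 6 6, loc x y 7 6, loc x y 6 7, loc x y 7 7, loc x y 7 4, loc x y 6 4,
     loc x y 6 3, loc x y 6 5, loc x y 5 3, loc x y 3 3, loc x y 4 3, loc x y 4 4}"
  have bl: "black_at b (loc x y 7 3)" "black_at b (loc x y 8 3)"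
    "black_at b (loc x y 8 4)" "black_at b (loc x y 9 4)" "black_at b (loc x y 7 5)"
    "black_at b (loc x y 8 5)" "black_at b (loc x y 9 5)" "black_at b (loc x y 6 6)"
    "black_at b (loc x y 7 6)" "black_at b (loc x y 6 7)" "black_at b (loc x y 7 7)"
    and c: "b (loc x y 7 4) = Some (Black, King)" "b (loc x y 5 3) = Some (Red, Pawn)"
      "b (loc x y 6 4) = Some (Red, Pawn)"
     "b (loc x y 6 3) = None" "b (loc x y 6 5) = None" and rp: "red_pawns b"
    using a by (auto simp: armed_def)
  have f': "b (loc x y 4 4) = None" "b (loc x y 3 3) = Some (Red, Pawn)" "b (loc x y 5 2) = Some (Red, Pawn)"
    "\<not> black_at b (loc x y 5 4)" "\<not> black_at b (loc x y 4 5)" "\<not> black_at b (loc x y 2 3)"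
    "\<not> black_at b (loc x y 3 2)"
    using f by (auto simp: sealed_def)
  have g: "guarded b F"
    unfolding guarded_def F_def using bl c f' w by (auto; fastforce?)
  note rm = red_move[OF g rp m]
  have "armed x y b' \<and> b' (loc x y 4 3) = Some (Black, Pawn) \<or> released x y b'"
    using rm(4)
  proof
    assume "\<forall>s\<in>F. b' s = b s"
    then show ?thesis using bl c w rm(2) by (auto simp: F_def armed_def)
  next
    assume "\<exists>s d. d \<in> dirs_down \<and> b s = Some (Red, Pawn) \<and> b (s \<oplus> d) = None \<and>
        b' = b(s := None, s \<oplus> d := Some (Red, Pawn))"
    then obtain s d where sd: "d \<in> dirs_down" "b s = Some (Red, Pawn)" "b (s \<oplus> d) = None"
        "b' = b(s := None, s \<oplus> d := Some (Red, Pawn))" by blast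
    show ?thesis
    proof (cases "s = loc x y 6 4")
      case True
      then show ?thesis using released_vacate[OF a] sd by auto
    next
      case False
      \<comment> \<open>A simple move may vacate \<open>(3,3)\<close> or fill \<open>(4,4)\<close>,
        but this comes too late: the double jump uses neither square.\<close>
      define F' where "F' = F - {loc x y 6 4, loc x y 3 3, loc x y 4 4}"
      have "s \<noteq> loc x y 5 3" using sd(1,3) f' w by auto
      then have "s \<notin> F'" using sd(2) bl c w unfolding F_def F'_def by auto
      moreover have "s \<oplus> d \<notin> F'"
        using sd(1,2,3) bl c w False unfolding F_def F'_def by (auto simp: add_eq_loc)
      moreover have "s \<oplus> d \<noteq> loc x y 6 4" using sd(3) c by auto
      ultimately have "\<forall>t\<in>insert (loc x y 6 4) F'. b' t = b t" using sd(4) False by auto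
      then show ?thesis using bl c w rm(2) by (auto simp: F_def F'_def armed_def)
    qed
  qed
  then obtain b'' where "released x y b'' \<and> (b'' = b' \<or> move (b', Black) (b'', Red))"
    using double_jump by blast
  then show False
    using released_no_value[OF v] val_le_BlackD[OF v] released_no_value[of "(b'', Red)" \<beta> x y]
    by auto
qed

text \<open>The same protection for a walker one square lower, on \<open>(4,2)\<close>:
  \<open>(3,2)\<close> blocks its capture by \<open>(5,2)\<close>, the pawn on \<open>(5,2)\<close>
  is held by the walker and \<open>(5,1)\<close>, and the pawn on \<open>(3,3)\<close> is held by
  \<open>(2,3)\<close> and \<open>(3,2)\<close>. With no black piece on \<open>(2,2)\<close> or
  \<open>(3,1)\<close>, the pawn on \<open>(3,2)\<close> cannot jump away.\<close>

definition gate :: "int \<Rightarrow> int \<Rightarrow> board \<Rightarrow> bool" where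
  "gate x y b \<longleftrightarrow> armed x y b \<and> sealed x y b \<and> b (loc x y 4 3) = None \<and>
     b (loc x y 3 2) = Some (Red, Pawn) \<and> b (loc x y 5 1) = Some (Red, Pawn) \<and>
     b (loc x y 2 3) = Some (Red, Pawn) \<and> (\<forall>(i, j) \<in> {(2,2), (3,1)}. \<not> black_at b (loc x y i j))"

text \<open>Red must shut the door, or fill \<open>(4,4)\<close>, from where a walker on the
  entrance could be captured into \<open>(4,2)\<close>. After any other reply the walker enters or
  the king is already free.\<close>

lemma gate_forced:
  assumes ga: "gate x y b" and w: "b (loc x y 4 2) = Some (Black, Pawn)" and v: "val_le (b, Red) \<gamma>"
  shows "\<exists>i j i' j' \<beta>. \<beta> < \<gamma> \<and> (i, j, i', j') \<in> {(5,3,4,3), (5,4,4,4), (4,5,4,4)} \<and>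
    val_le (b(loc x y i j := None, loc x y i' j' := Some (Red, Pawn)), Black) \<beta>"
proof -
  obtain b' \<beta> where m: "move (b, Red) (b', Black)" and v: "val_le (b', Black) \<beta>" and "\<beta> < \<gamma>"
    using v by (rule val_le_RedE)
  define F where "F = {loc x y 7 3, loc x y 8 3, loc x y 8 4, loc x y 9 4, loc x y 7 5, loc x y 8 5,
     loc x y 9 5, loc x y 6 6, loc x y 7 6, loc x y 6 7, loc x y 7 7, loc x y 7 4, loc x y 6 4,
     loc x y 6 3, loc x y 6 5, loc x y 5 3, loc x y 3 3, loc x y 4 3, loc x y 4 4,
     loc x y 4 2, loc x y 3 2, loc x y 5 2}"
  have a: "armed x y b" using ga by (simp add: gate_def)
  have bl: "black_at b (loc x y 7 3)" "black_at b (loc x y 8 3)"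
    "black_at b (loc x y 8 4)" "black_at b (loc x y 9 4)" "black_at b (loc x y 7 5)"
    "black_at b (loc x y 8 5)" "black_at b (loc x y 9 5)" "black_at b (loc x y 6 6)"
    "black_at b (loc x y 7 6)" "black_at b (loc x y 6 7)" "black_at b (loc x y 7 7)"
    and c: "b (loc x y 7 4) = Some (Black, King)" "b (loc x y 5 3) = Some (Red, Pawn)"
      "b (loc x y 6 4) = Some (Red, Pawn)"
     "b (loc x y 6 3) = None" "b (loc x y 6 5) = None" and rp: "red_pawns b"
    using a by (auto simp: armed_def)
  have f: "b (loc x y 4 4) = None" "b (loc x y 3 3) = Some (Red, Pawn)" "b (loc x y 5 2) = Some (Red, Pawn)"
    "\<not> black_at b (loc x y 5 4)" "\<not> black_at b (loc x y 4 5)" "\<not> black_at b (loc x y 2 3)"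
    "\<not> black_at b (loc x y 3 2)" "b (loc x y 4 3) = None" "b (loc x y 3 2) = Some (Red, Pawn)"
    "b (loc x y 5 1) = Some (Red, Pawn)" "b (loc x y 2 3) = Some (Red, Pawn)"
    "\<not> black_at b (loc x y 2 2)" "\<not> black_at b (loc x y 3 1)"
    using ga by (auto simp: sealed_def gate_def)
  have g: "guarded b F"
    unfolding guarded_def F_def using bl c f w by (auto; fastforce?)
  note rm = red_move[OF g rp m]
  \<comment> \<open>The walker steps onto the entrance. The pawn on \<open>(3,2)\<close> may have
    moved: it protected the walker on \<open>(4,2)\<close>, whereas \<open>sealed\<close> only asks
    that no black piece be there.\<close>
  have enter: False if keep: "\<forall>s\<in>F - {loc x y 3 2}. b' s = b s"
  proof -
    define b2 where "b2 = b'(loc x y 4 2 := None, loc x y 4 3 := Some (Black, Pawn))"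
    have k: "b' (loc x y 7 3) = b (loc x y 7 3)"
      "b' (loc x y 8 3) = b (loc x y 8 3)"
      "b' (loc x y 8 4) = b (loc x y 8 4)"
      "b' (loc x y 9 4) = b (loc x y 9 4)"
      "b' (loc x y 7 5) = b (loc x y 7 5)"
      "b' (loc x y 8 5) = b (loc x y 8 5)"
      "b' (loc x y 9 5) = b (loc x y 9 5)"
      "b' (loc x y 6 6) = b (loc x y 6 6)"
      "b' (loc x y 7 6) = b (loc x y 7 6)"
      "b' (loc x y 6 7) = b (loc x y 6 7)"
      "b' (loc x y 7 7) = b (loc x y 7 7)"
      "b' (loc x y 7 4) = b (loc x y 7 4)"
      "b' (loc x y 6 4) = b (loc x y 6 4)"
      "b' (loc x y 6 3) = b (loc x y 6 3)"
      "b' (loc x y 6 5) = b (loc x y 6 5)"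
      "b' (loc x y 5 3) = b (loc x y 5 3)"
      "b' (loc x y 3 3) = b (loc x y 3 3)"
      "b' (loc x y 4 3) = b (loc x y 4 3)"
      "b' (loc x y 4 4) = b (loc x y 4 4)"
      "b' (loc x y 4 2) = b (loc x y 4 2)"
      "b' (loc x y 5 2) = b (loc x y 5 2)"
      using keep by (simp_all add: F_def)
    have nb: "\<not> black_at b' s" if "\<not> black_at b s" for s using rm(3) that by blast
    have "move (b', Black) (b2, Red)"
      using move_simple[of b' "loc x y 4 2" Black Pawn "(-1,1)"] k w f by (simp add: b2_def)
    then have "val_le (b2, Red) \<beta>" by (rule val_le_BlackD[OF v])
    moreover have "armed x y b2"
      using bl c rm(2) by (simp add: b2_def armed_def red_pawns_def k)
    moreover have "sealed x y b2"
      using f nb by (simp add: b2_def sealed_def k)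
    ultimately show False using entered_no_value[of x y b2 \<beta>] by (simp add: b2_def)
  qed
  show ?thesis
    using rm(4)
  proof
    assume "\<forall>s\<in>F. b' s = b s"
    then show ?thesis using enter by blast
  next
    assume "\<exists>s d. d \<in> dirs_down \<and> b s = Some (Red, Pawn) \<and> b (s \<oplus> d) = None \<and>
        b' = b(s := None, s \<oplus> d := Some (Red, Pawn))"
    then obtain s d where sd: "d \<in> dirs_down" "b s = Some (Red, Pawn)" "b (s \<oplus> d) = None"
        "b' = b(s := None, s \<oplus> d := Some (Red, Pawn))" by blast
    consider "s = loc x y 6 4" | "s = loc x y 5 3" | "s \<oplus> d = loc x y 4 4"
      | "s \<noteq> loc x y 6 4" "s \<noteq> loc x y 5 3" "s \<oplus> d \<noteq> loc x y 4 4" by blast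
    then show ?thesis
    proof cases
      case 1
      then have "released x y b'" using released_vacate[OF a] sd by auto
      then show ?thesis using released_no_value[OF v] by simp
    next
      case 2
      then have "s \<oplus> d = loc x y 4 3" using sd(1,3) f by auto
      with 2 sd(4) v \<open>\<beta> < \<gamma>\<close> show ?thesis
        by (intro exI[of _ 5] exI[of _ 3] exI[of _ 4] exI[of _ 3] exI[of _ \<beta>]) simp
    next
      case 3
      then have "s = loc x y 5 4 \<or> s = loc x y 4 5" using sd(1) by (auto simp: add_eq_loc)
      then show ?thesis
      proof
        assume "s = loc x y 5 4"
        with 3 sd(4) v \<open>\<beta> < \<gamma>\<close> show ?thesis
          by (intro exI[of _ 5] exI[of _ 4] exI[of _ 4] exI[of _ 4] exI[of _ \<beta>]) simp
      next
        assume "s = loc x y 4 5"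
        with 3 sd(4) v \<open>\<beta> < \<gamma>\<close> show ?thesis
          by (intro exI[of _ 4] exI[of _ 5] exI[of _ 4] exI[of _ 4] exI[of _ \<beta>]) simp
      qed
    next
      case 4
      have "s \<noteq> loc x y 3 3" "s \<noteq> loc x y 5 2" using sd(1,3) f w by auto
      then have "s \<notin> F - {loc x y 3 2}" using sd(2) bl c f w 4 unfolding F_def by auto
      moreover have "s \<oplus> d \<notin> F"
        using sd(1,2,3) bl c f w 4 unfolding F_def by (auto simp: add_eq_loc)
      ultimately have "\<forall>t\<in>F - {loc x y 3 2}. b' t = b t" using sd(4) by auto
      then show ?thesis using enter by blast
    qed
  qed
qed

section \<open>The board\<close>

text \<open>Coordinates inverse to \<open>loc\<close>: half of the sum is \<open>u\<close>, half of
  the difference is \<open>v\<close>, and the shear is subtracted from \<open>v\<close> before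
  dividing.\<close>

definition cell_x :: "square \<Rightarrow> int" where "cell_x s = (fst s + snd s) div 2 div 16"
definition cell_i :: "square \<Rightarrow> int" where "cell_i s = (fst s + snd s) div 2 mod 16"
definition cell_y :: "square \<Rightarrow> int" where "cell_y s = ((snd s - fst s) div 2 - 2 * cell_x s) div 16"
definition cell_j :: "square \<Rightarrow> int" where "cell_j s = ((snd s - fst s) div 2 - 2 * cell_x s) mod 16"

lemma cell_loc [simp]:
  assumes "0 \<le> i" "i < 16" "0 \<le> j" "j < 16"
  shows "cell_x (loc x y i j) = x" "cell_y (loc x y i j) = y"
    "cell_i (loc x y i j) = i" "cell_j (loc x y i j) = j"
proof -
  have "(fst (loc x y i j) + snd (loc x y i j)) div 2 = i + x * 16" by (simp add: loc_def)
  then show 1: "cell_x (loc x y i j) = x" "cell_i (loc x y i j) = i"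
    using assms by (simp_all add: cell_x_def cell_i_def)
  have "(snd (loc x y i j) - fst (loc x y i j)) div 2 - 2 * x = j + y * 16" by (simp add: loc_def)
  then show "cell_y (loc x y i j) = y" "cell_j (loc x y i j) = j"
    using assms by (simp_all add: cell_y_def cell_j_def 1)
qed

lemma loc_cell:
  assumes "dark s"
  shows "s = loc (cell_x s) (cell_y s) (cell_i s) (cell_j s)"
proof -
  define u v where "u = (fst s + snd s) div 2" and "v = (snd s - fst s) div 2"
  have e: "even (fst s + snd s)" using assms by (simp add: dark_def)
  have "fst s = u - v" "snd s = u + v" using e unfolding u_def v_def by presburger+
  then have s: "s = (u - v, u + v)" by (simp add: prod_eq_iff)
  have "16 * cell_x s + cell_i s = u" by (simp add: cell_x_def cell_i_def u_def)
  moreover have "16 * cell_y s + cell_j s = v - 2 * cell_x s"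
    by (simp add: cell_y_def cell_j_def v_def)
  ultimately show ?thesis by (subst s) (simp add: loc_def)
qed

lemma cell_range [simp]: "0 \<le> cell_i s" "cell_i s < 16" "0 \<le> cell_j s" "cell_j s < 16"
  by (simp_all add: cell_i_def cell_j_def)

lemma dark_loc [simp]: "dark (loc x y i j)"
  by (simp add: dark_def loc_def)

lemma loc_wrap: "loc x y 16 2 = loc (x + 1) y 0 0" "loc x y 0 16 = loc x (y + 1) 0 0"
  by (simp_all add: loc_def)

lemma snd_loc: "snd (loc x y i j) = 18 * x + 16 * y + i + j"
  by (simp add: loc_def)

lemma snd_dirs_up: "d \<in> dirs_up \<Longrightarrow> snd (s \<oplus> d) = snd s + 1"
  by (auto simp: sq_add_def)

text \<open>The flags tell whether the cell has an upward lane, a rightward lane, and a gate at \<open>(4,2)\<close> on the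
  latter. Above the gate are the entrance \<open>(4,3)\<close> with room \<open>(4,4)\<close>, the door pawn \<open>(5,3)\<close>, which Red
  moves to \<open>(4,3)\<close>, and the pawn \<open>(6,4)\<close>, which cannot move without releasing the king on \<open>(7,4)\<close>.
  From the entrance the walker jumps over both pawns via \<open>(6,3)\<close> to \<open>(6,5)\<close>.\<close>
definition content :: "bool \<Rightarrow> bool \<Rightarrow> bool \<Rightarrow> int \<Rightarrow> int \<Rightarrow> piece option" where
  "content u r g i j =
    (if i = 0 \<and> even j \<and> (j = 0 \<or> u) \<or> r \<and> even i \<and> (j = 0 \<and> i \<le> 4 \<or> j = 2 \<and> 4 \<le> i) then None
     else if g \<and> (i, j) \<in> {(4,3), (4,4), (6,3), (6,5)} then None
     else if g \<and> (i, j) = (7,4) then Some (Black, King)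
     else if g \<and> (i, j) \<in> wall_squares then Some (Black, Pawn)
     else Some (Red, Pawn))"

text \<open>Contains the pawns between the landing squares as well, and ignores the flags, so that
  it depends on the place inside the cell alone.\<close>

definition lane :: "square \<Rightarrow> bool" where
  "lane s \<longleftrightarrow> cell_i s = 0 \<or> cell_j s = 0 \<and> cell_i s \<le> 4 \<or> cell_i s = 4 \<and> cell_j s = 1 \<or>
     cell_j s = 2 \<and> 4 \<le> cell_i s"

definition gadget_zone :: "square \<Rightarrow> bool" where
  "gadget_zone s \<longleftrightarrow> 3 \<le> cell_i s \<and> 3 \<le> cell_j s"

text \<open>The second coordinate of \<open>loc x y 4 2\<close> in the cell of \<open>s\<close>. It
  orders the gates along the walker's ascent.\<close>

definition gate_height :: "square \<Rightarrow> int" where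
  "gate_height s = 18 * cell_x s + 16 * cell_y s + 6"

locale board_tracks =
  fixes U R G :: "int \<Rightarrow> int \<Rightarrow> bool"
  assumes G_R: "G x y \<Longrightarrow> R x y"
begin

definition board0 :: board where
  "board0 s = (if dark s then content (U (cell_x s) (cell_y s)) (R (cell_x s) (cell_y s))
      (G (cell_x s) (cell_y s)) (cell_i s) (cell_j s) else None)"

lemma board0_loc [simp]:
  "0 \<le> i \<Longrightarrow> i < 16 \<Longrightarrow> 0 \<le> j \<Longrightarrow> j < 16 \<Longrightarrow>
    board0 (loc x y i j) = content (U x y) (R x y) (G x y) i j"
  by (simp add: board0_def)

definition door :: "square \<Rightarrow> bool" where
  "door s \<longleftrightarrow> G (cell_x s) (cell_y s) \<and> (cell_i s, cell_j s) \<in> {(4,3), (5,3)}"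

lemma red_pawns_board0: "red_pawns board0"
  by (auto simp: red_pawns_def board0_def content_def split: if_splits)

section \<open>The walker's landing squares and hops\<close>

inductive spot :: "square \<Rightarrow> bool" where
  spot_up: "even j \<Longrightarrow> 0 \<le> j \<Longrightarrow> j \<le> 14 \<Longrightarrow> j = 0 \<or> U x y \<Longrightarrow> spot (loc x y 0 j)"
| spot_low: "R x y \<Longrightarrow> i = 2 \<or> i = 4 \<Longrightarrow> spot (loc x y i 0)"
| spot_high: "R x y \<Longrightarrow> even i \<Longrightarrow> 4 \<le> i \<Longrightarrow> i \<le> 14 \<Longrightarrow> spot (loc x y i 2)"

inductive hop :: "square \<Rightarrow> square \<Rightarrow> bool" where
  hop_up: "U x y \<Longrightarrow> even j \<Longrightarrow> 0 \<le> j \<Longrightarrow> j \<le> 14 \<Longrightarrow> hop (loc x y 0 j) (-1, 1)"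
| hop_low: "R x y \<Longrightarrow> i = 0 \<or> i = 2 \<Longrightarrow> hop (loc x y i 0) (1, 1)"
| hop_corner: "R x y \<Longrightarrow> hop (loc x y 4 0) (-1, 1)"
| hop_high: "R x y \<Longrightarrow> even i \<Longrightarrow> 4 \<le> i \<Longrightarrow> i \<le> 14 \<Longrightarrow> hop (loc x y i 2) (1, 1)"

lemma hop_facts:
  assumes "hop p d"
  shows "d \<in> dirs_up" "lane p" "lane (p \<oplus> d)" "lane (p \<oplus> d \<oplus> d)"
    "board0 (p \<oplus> d) = Some (Red, Pawn)" "board0 (p \<oplus> d \<oplus> d) = None"
    "spot p" "spot (p \<oplus> d \<oplus> d)"
proof -
  have "d \<in> dirs_up \<and> lane p \<and> lane (p \<oplus> d) \<and> lane (p \<oplus> d \<oplus> d) \<and>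
    board0 (p \<oplus> d) = Some (Red, Pawn) \<and> board0 (p \<oplus> d \<oplus> d) = None \<and> spot p \<and> spot (p \<oplus> d \<oplus> d)"
    using assms
  proof cases
    case (hop_up x y j)
    then have "j \<le> 12 \<or> j = 14" by presburger
    then show ?thesis
    proof
      assume "j \<le> 12"
      then show ?thesis using hop_up spot_up[of j x y] spot_up[of "j + 2" x y]
        by (auto simp: lane_def content_def add.assoc)
    next
      assume "j = 14"
      then show ?thesis using hop_up spot_up[of j x y] spot_up[of 0 x "y + 1"]
        by (auto simp: lane_def content_def loc_wrap)
    qed
  next
    case (hop_low x y i)
    then show ?thesis using spot_up[of 0 x y] spot_low[of x y 2] spot_low[of x y 4]
      by (auto simp: lane_def content_def)
  next
    case (hop_corner x y)
    then show ?thesis using spot_low[of x y 4] spot_high[of x y 4]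
      by (auto simp: lane_def content_def)
  next
    case (hop_high x y i)
    then have "i \<le> 12 \<or> i = 14" by presburger
    then show ?thesis
    proof
      assume "i \<le> 12"
      then show ?thesis using hop_high spot_high[of x y i] spot_high[of x y "i + 2"]
        by (auto simp: lane_def content_def add.assoc)
    next
      assume "i = 14"
      then show ?thesis using hop_high spot_high[of x y i] spot_up[of 0 "x + 1" y]
        by (auto simp: lane_def content_def loc_wrap)
    qed
  qed
  then show "d \<in> dirs_up" "lane p" "lane (p \<oplus> d)" "lane (p \<oplus> d \<oplus> d)"
    "board0 (p \<oplus> d) = Some (Red, Pawn)" "board0 (p \<oplus> d \<oplus> d) = None"
    "spot p" "spot (p \<oplus> d \<oplus> d)" by blast+
qed

text \<open>With \<open>Z = gadget_zone\<close> this leaves room for all of Red's ways to block an entrance; with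
  \<open>Z = door\<close> it describes the boards arising from Red's own strategy.\<close>
definition walking :: "(square \<Rightarrow> bool) \<Rightarrow> int \<Rightarrow> board \<Rightarrow> square \<Rightarrow> bool" where
  "walking Z c b w \<longleftrightarrow> red_pawns b \<and> b w = Some (Black, Pawn) \<and>
     (\<forall>s. s \<noteq> w \<longrightarrow> b s \<noteq> board0 s \<longrightarrow> lane s \<and> snd s \<le> snd w \<or> Z s \<and> gate_height s < c)"

definition hop_board :: "board \<Rightarrow> square \<Rightarrow> square \<Rightarrow> board" where
  "hop_board b w d = b(w := None, w \<oplus> d := None, w \<oplus> d \<oplus> d := b w)"

lemma jump_res_hop: "jump_res b w d = (hop_board b w d, w \<oplus> d \<oplus> d)"
  by (simp add: jump_res_def hop_board_def)

lemma walking_ahead: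
  assumes "walking Z c b w" "lane s" "\<And>s. Z s \<Longrightarrow> \<not> lane s" "snd w < snd s"
  shows "b s = board0 s"
proof -
  have "s \<noteq> w" using assms(4) by auto
  moreover have "\<not> Z s" using assms(2,3) by blast
  ultimately show ?thesis using assms(1,4) unfolding walking_def by (meson not_le)
qed

text \<open>Damage to lanes lies at or below the walker's height and a hop leads upwards, so both
  squares ahead are as on \<open>board0\<close>; the squares emptied by the hop are again not above
  the walker.\<close>

lemma hop_walking:
  assumes wk: "walking Z c b w" and h: "hop w d" and Z: "\<And>s. Z s \<Longrightarrow> \<not> lane s"
  shows "jump_ok b w d" "walking Z c (hop_board b w d) (w \<oplus> d \<oplus> d)"
    "snd (w \<oplus> d \<oplus> d) = snd w + 2"
proof -
  note hf = hop_facts[OF h]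
  have up: "snd (w \<oplus> d) = snd w + 1" "snd (w \<oplus> d \<oplus> d) = snd w + 2"
    using snd_dirs_up[OF hf(1)] by simp_all
  have m: "b (w \<oplus> d) = Some (Red, Pawn)" "b (w \<oplus> d \<oplus> d) = None"
    using walking_ahead[OF wk hf(3) Z] walking_ahead[OF wk hf(4) Z] hf up by auto
  have w: "b w = Some (Black, Pawn)" using wk by (simp add: walking_def)
  show "jump_ok b w d" using m w hf(1) by (simp add: jump_ok_def)
  show "snd (w \<oplus> d \<oplus> d) = snd w + 2" by (rule up)
  have rp: "red_pawns (hop_board b w d)"
    using wk by (auto simp: walking_def red_pawns_def hop_board_def)
  have "lane s \<and> snd s \<le> snd (w \<oplus> d \<oplus> d) \<or> Z s \<and> gate_height s < c"
    if "s \<noteq> w \<oplus> d \<oplus> d" "hop_board b w d s \<noteq> board0 s" for s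
  proof (cases "s = w \<or> s = w \<oplus> d")
    case True
    then show ?thesis using hf up by auto
  next
    case False
    then have "b s \<noteq> board0 s" using that by (simp add: hop_board_def)
    then show ?thesis using wk False up unfolding walking_def by force
  qed
  then show "walking Z c (hop_board b w d) (w \<oplus> d \<oplus> d)"
    unfolding walking_def using rp w by (simp add: hop_board_def)
qed

definition hops :: "square \<Rightarrow> square \<Rightarrow> bool" where
  "hops = (\<lambda>p q. \<exists>d. hop p d \<and> q = p \<oplus> d \<oplus> d)\<^sup>+\<^sup>+"

lemma hops_jump_seq:
  assumes "hops w q" "walking Z c b w" "\<And>s. Z s \<Longrightarrow> \<not> lane s"
  shows "\<exists>b'. jump_seq (b, w) (b', q) \<and> walking Z c b' q \<and> snd w + 2 \<le> snd q"
  using assms(1) unfolding hops_def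
proof (induction rule: tranclp_induct)
  case (base q)
  then obtain d where d: "hop w d" "q = w \<oplus> d \<oplus> d" by blast
  note hw = hop_walking[OF assms(2) d(1) assms(3)]
  show ?case using jump_one[OF hw(1)] hw(2,3) d by (auto simp: jump_res_hop)
next
  case (step p q)
  then obtain b' where b': "jump_seq (b, w) (b', p)" "walking Z c b' p" "snd w + 2 \<le> snd p" by blast
  obtain d where d: "hop p d" "q = p \<oplus> d \<oplus> d" using step.hyps(2) by blast
  note hw = hop_walking[OF b'(2) d(1) assms(3)]
  show ?case using jump_snoc[OF b'(1) hw(1)] hw(2,3) d b'(3) by (auto simp: jump_res_hop)
qed

lemma zone_not_lane: "gadget_zone s \<Longrightarrow> \<not> lane s"
  by (auto simp: gadget_zone_def lane_def)

text \<open>The squares that matter are off the lanes or above the walker, and the bound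
  \<open>c\<close> says that no gadget at this height or above has been altered.\<close>

lemma walking_gate:
  assumes wk: "walking gadget_zone c b (loc x y 4 2)" and g: "G x y" and c: "c \<le> 18 * x + 16 * y + 6"
  shows "gate x y b"
proof -
  have r: "R x y" using g by (rule G_R)
  have *: "b (loc x y i j) = content (U x y) True True i j"
    if "0 \<le> i" "i < 16" "0 \<le> j" "j < 16" "lane (loc x y i j) \<longrightarrow> 6 < i + j" "(i, j) \<noteq> (4, 2)" for i j
  proof -
    have "loc x y i j \<noteq> loc x y 4 2" using that(6) by simp
    moreover have "\<not> (lane (loc x y i j) \<and> snd (loc x y i j) \<le> snd (loc x y 4 2))"
      using that(5) by (auto simp: snd_loc)
    moreover have "\<not> gate_height (loc x y i j) < c" using that c by (simp add: gate_height_def)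
    ultimately have "b (loc x y i j) = board0 (loc x y i j)"
      using wk unfolding walking_def by blast
    then show ?thesis using that r g by simp
  qed
  show ?thesis
    using wk unfolding gate_def armed_def sealed_def
    by (simp add: * lane_def content_def walking_def)
qed

text \<open>Each of the replies alters the zone of this cell only; the new bound is one above its
  gate height, hence still at most the height of any later gate.\<close>

lemma walking_closed:
  assumes wk: "walking gadget_zone c b w" and c: "c \<le> 18 * x + 16 * y + 6" and w: "w = loc x y 4 2"
    and ij: "(i, j, i', j') \<in> {(5,3,4,3), (5,4,4,4), (4,5,4,4)}"
  shows "walking gadget_zone (18 * x + 16 * y + 7) (b(loc x y i j := None, loc x y i' j' := Some (Red, Pawn))) w"
proof -
  let ?b = "b(loc x y i j := None, loc x y i' j' := Some (Red, Pawn))"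
  have "red_pawns ?b" using wk by (auto simp: walking_def red_pawns_def)
  moreover have "?b w = Some (Black, Pawn)" using wk ij w by (auto simp: walking_def)
  moreover have "lane s \<and> snd s \<le> snd w \<or> gadget_zone s \<and> gate_height s < 18 * x + 16 * y + 7"
    if "s \<noteq> w" "?b s \<noteq> board0 s" for s
  proof (cases "s = loc x y i j \<or> s = loc x y i' j'")
    case True
    then show ?thesis using ij by (auto simp: gadget_zone_def gate_height_def)
  next
    case False
    then have "b s \<noteq> board0 s" using that by simp
    then show ?thesis using wk that(1) c unfolding walking_def by force
  qed
  ultimately show ?thesis by (simp add: walking_def)
qed

end

section \<open>Black survives\<close>

locale labelled_tracks = board_tracks +
  fixes lab :: "int \<Rightarrow> int \<Rightarrow> 'o::wellorder"
  assumes label_U: "U x y \<Longrightarrow> lab x (y + 1) = lab x y"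
    and label_R: "R x y \<Longrightarrow> \<not> G x y \<Longrightarrow> lab (x + 1) y = lab x y"
    and label_G: "G x y \<Longrightarrow> lab (x + 1) y < lab x y"
    and cells: "G x y \<Longrightarrow> 0 \<le> x \<and> 0 \<le> y"
    and branches: "0 \<le> x \<Longrightarrow> 0 \<le> y \<Longrightarrow> \<beta> < lab x y \<Longrightarrow> \<exists>x' y'.
      (\<lambda>(x, y) (x', y'). x' = x \<and> y' = y + 1 \<and> U x y \<or> x' = x + 1 \<and> y' = y \<and> R x y)\<^sup>*\<^sup>* (x, y) (x', y') \<and>
      G x' y' \<and> lab (x' + 1) y' = \<beta>"
begin

text \<open>From the corner \<open>(4,2)\<close> on, the walker is counted as having passed to the
  next cell, so the label falls at the hop onto the gate.\<close>

definition label :: "square \<Rightarrow> 'o" where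
  "label p = (if cell_j p = 2 \<and> 4 \<le> cell_i p then lab (cell_x p + 1) (cell_y p) else lab (cell_x p) (cell_y p))"

section \<open>Jump paths along the tracks\<close>

lemma hops_trans: "hops p q \<Longrightarrow> hops q r \<Longrightarrow> hops p r"
  unfolding hops_def by (rule tranclp_trans)

lemma hops_one: "hop p d \<Longrightarrow> q = p \<oplus> d \<oplus> d \<Longrightarrow> hops p q"
  unfolding hops_def by blast

lemma hops_up: "U x y \<Longrightarrow> hops (loc x y 0 0) (loc x (y + 1) 0 0)"
proof -
  assume u: "U x y"
  have *: "hops (loc x y 0 j) (loc x y 0 (j + 2))" if "even j" "0 \<le> j" "j \<le> 14" for j
    by (rule hops_one[OF hop_up[OF u that]]) (simp add: add.assoc)
  have "hops (loc x y 0 0) (loc x y 0 (2 * int (Suc n)))" if "n \<le> 7" for n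
    using that
  proof (induction n)
    case 0
    then show ?case using *[of 0] by simp
  next
    case (Suc n)
    then show ?case using hops_trans[OF _ *[of "2 * int (Suc n)"]] by (simp add: algebra_simps)
  qed
  from this[of 7] show ?thesis by (simp add: loc_wrap)
qed

lemma hops_right_from_corner: "R x y \<Longrightarrow> hops (loc x y 4 2) (loc (x + 1) y 0 0)"
proof -
  assume r: "R x y"
  have *: "hops (loc x y i 2) (loc x y (i + 2) 2)" if "even i" "4 \<le> i" "i \<le> 14" for i
    by (rule hops_one[OF hop_high[OF r that]]) (simp add: add.assoc)
  have "hops (loc x y 4 2) (loc x y (4 + 2 * int (Suc n)) 2)" if "n \<le> 5" for n
    using that
  proof (induction n)
    case 0
    then show ?case using *[of 4] by simp
  next
    case (Suc n)
    then show ?case using hops_trans[OF _ *[of "4 + 2 * int (Suc n)"]] by (simp add: algebra_simps)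
  qed
  from this[of 5] show ?thesis by (simp add: loc_wrap)
qed

lemma hops_to_corner: "R x y \<Longrightarrow> hops (loc x y 0 0) (loc x y 4 2)"
proof -
  assume r: "R x y"
  have "hops (loc x y 0 0) (loc x y 2 0)" "hops (loc x y 2 0) (loc x y 4 0)"
    "hops (loc x y 4 0) (loc x y 4 2)"
    using hops_one[OF hop_low[OF r, of 0]] hops_one[OF hop_low[OF r, of 2]]
      hops_one[OF hop_corner[OF r]] by simp_all
  then show ?thesis using hops_trans by blast
qed

lemma hops_edges:
  assumes "(\<lambda>(x, y) (x', y'). x' = x \<and> y' = y + 1 \<and> U x y \<or> x' = x + 1 \<and> y' = y \<and> R x y)\<^sup>*\<^sup>* p q"
  shows "p = q \<or> hops (loc (fst p) (snd p) 0 0) (loc (fst q) (snd q) 0 0)"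
  using assms
proof (induction rule: rtranclp_induct)
  case (step q r)
  have "hops (loc (fst q) (snd q) 0 0) (loc (fst r) (snd r) 0 0)"
    using step.hyps(2) hops_up hops_trans[OF hops_to_corner hops_right_from_corner]
    by (auto split: prod.splits)
  then show ?case using step.IH hops_trans by blast
qed simp

lemma branch_from_vertex:
  assumes "0 \<le> x" "0 \<le> y" "\<beta> < lab x y"
  shows "\<exists>x' y'. hops (loc x y 0 0) (loc x' y' 4 2) \<and> G x' y' \<and> lab (x' + 1) y' = \<beta>"
proof -
  obtain x' y' where *: "(\<lambda>(x, y) (x', y'). x' = x \<and> y' = y + 1 \<and> U x y \<or>
      x' = x + 1 \<and> y' = y \<and> R x y)\<^sup>*\<^sup>* (x, y) (x', y')" "G x' y'" "lab (x' + 1) y' = \<beta>"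
    using branches[OF assms] by blast
  from hops_edges[OF *(1)] hops_to_corner[OF G_R[OF *(2)]]
  have "hops (loc x y 0 0) (loc x' y' 4 2)"
    by (elim disjE) (simp, metis hops_trans fst_conv snd_conv)
  then show ?thesis using * by blast
qed

definition at_rest :: "square \<Rightarrow> bool" where
  "at_rest w \<longleftrightarrow> w = loc 0 0 0 0 \<or> (\<exists>x y. G x y \<and> w = loc x y 4 2)"

lemma branch_from_rest:
  assumes "at_rest w" "\<beta> < label w"
  shows "\<exists>x y. hops w (loc x y 4 2) \<and> G x y \<and> lab (x + 1) y = \<beta>"
  using assms(1) unfolding at_rest_def
proof
  assume "w = loc 0 0 0 0"
  then show ?thesis using branch_from_vertex[of 0 0 \<beta>] assms(2) by (simp add: label_def)
next
  assume "\<exists>x y. G x y \<and> w = loc x y 4 2"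
  then obtain x y where w: "G x y" "w = loc x y 4 2" by blast
  then have "\<beta> < lab (x + 1) y" "0 \<le> x + 1" "0 \<le> y"
    using assms(2) cells[OF w(1)] by (auto simp: label_def)
  then obtain x' y' where "hops (loc (x + 1) y 0 0) (loc x' y' 4 2)" "G x' y'" "lab (x' + 1) y' = \<beta>"
    using branch_from_vertex by blast
  then show ?thesis using hops_trans[OF hops_right_from_corner[OF G_R[OF w(1)]]] w(2) by blast
qed

text \<open>Against a supposed bound \<open>\<gamma>\<close> below the label, Black jumps to a gate
  whose label is exactly \<open>\<gamma>\<close>. Red's forced reply must lower the bound below
  \<open>\<gamma>\<close>, which contradicts the induction hypothesis there.\<close>

lemma value_ge_label:
  assumes "walking gadget_zone c b w" "at_rest w" "c \<le> snd w + 1" "\<gamma> < label w"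
  shows "\<not> val_le (b, Black) \<gamma>"
  using assms
proof (induction "label w" arbitrary: b w c \<gamma> rule: less_induct)
  case less
  show ?case
  proof
    assume v: "val_le (b, Black) \<gamma>"
    obtain x y where xy: "hops w (loc x y 4 2)" "G x y" "lab (x + 1) y = \<gamma>"
      using branch_from_rest less.prems by blast
    obtain b' where b': "jump_seq (b, w) (b', loc x y 4 2)" "walking gadget_zone c b' (loc x y 4 2)"
        "snd w + 2 \<le> snd (loc x y 4 2)"
      using hops_jump_seq[OF xy(1) less.prems(1) zone_not_lane] by blast
    have "b w = Some (Black, Pawn)" using less.prems(1) by (simp add: walking_def)
    then have "move (b, Black) (b', Red)" using move_jump_seq[OF b'(1)] by simp
    then have v': "val_le (b', Red) \<gamma>" by (rule val_le_BlackD[OF v])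
    \<comment> \<open>The path has at least one hop, of height two, so the new gate is strictly
      above all gates already spent.\<close>
    have c: "c \<le> 18 * x + 16 * y + 6" using less.prems(3) b'(3) by (simp add: snd_loc)
    have "b' (loc x y 4 2) = Some (Black, Pawn)" using b'(2) by (simp add: walking_def)
    from gate_forced[OF walking_gate[OF b'(2) xy(2) c] this v'] obtain i j i' j' \<beta>
      where \<beta>: "\<beta> < \<gamma>" and ij: "(i, j, i', j') \<in> {(5,3,4,3), (5,4,4,4), (4,5,4,4)}"
        and vb: "val_le (b'(loc x y i j := None, loc x y i' j' := Some (Red, Pawn)), Black) \<beta>"
      by blast
    have l: "label (loc x y 4 2) = \<gamma>" using xy(3) by (simp add: label_def)
    have "at_rest (loc x y 4 2)" using xy(2) unfolding at_rest_def by blast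
    then show False
      using less.hyps[OF _ walking_closed[OF b'(2) c refl ij], of \<beta>] less.prems(4) \<beta> vb l
      by (simp add: snd_loc)
  qed
qed

end

section \<open>Red wins\<close>

context board_tracks
begin

text \<open>The gadget and all squares up to two steps above the wall, without the door pawn. Red's
  strategy never changes them.\<close>

definition core :: "square \<Rightarrow> bool" where
  "core s \<longleftrightarrow> 5 \<le> cell_i s \<and> cell_i s \<le> 11 \<and> 3 \<le> cell_j s \<and> cell_j s \<le> 9 \<and>
     (cell_i s, cell_j s) \<noteq> (5,3)"

lemma core_not_lane: "core s \<Longrightarrow> \<not> lane s" and core_not_door: "core s \<Longrightarrow> \<not> door s"
  and door_not_lane: "door s \<Longrightarrow> \<not> lane s"
  by (auto simp: core_def lane_def door_def)

definition quiet :: "board \<Rightarrow> square \<Rightarrow> bool" where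
  "quiet b w \<longleftrightarrow> (\<forall>s. core s \<longrightarrow> b s = board0 s) \<and> (\<forall>s. s \<noteq> w \<longrightarrow> black_at b s \<longrightarrow> b s = board0 s)"

text \<open>Whether a shut-in piece can move is decided by squares in \<open>core\<close>, where the
  board is \<open>board0\<close>, so it can be read off \<open>content\<close>.\<close>

lemma quiet_blocked:
  assumes q: "quiet b w" and s: "s \<noteq> w" "b s = Some (Black, k)" and d: "allowed (Black, k) d"
  shows "b (s \<oplus> d) \<noteq> None" "\<not> jump_ok b s d"
proof -
  have b0: "board0 s = Some (Black, k)" using q s by (auto simp: quiet_def)
  then have "dark s" by (auto simp: board0_def split: if_splits)
  then obtain x y i j where loc: "s = loc x y i j" "0 \<le> i" "i < 16" "0 \<le> j" "j < 16"
    using loc_cell[of s] cell_range by blast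
  then have ij: "G x y" "k = King \<and> (i, j) = (7, 4) \<or> k = Pawn \<and> (i, j) \<in> wall_squares"
    using b0 by (auto simp: content_def split: if_splits)
  have c: "b (loc x y i j) = content (U x y) True True i j"
    if "5 \<le> i" "i \<le> 11" "3 \<le> j" "j \<le> 9" "(i, j) \<noteq> (5, 3)" for i j
    using q that ij(1) G_R[OF ij(1)] by (simp add: quiet_def core_def)
  have "b (s \<oplus> d) \<noteq> None \<and> \<not> jump_ok b s d"
    using ij(2)
  proof
    assume k: "k = King \<and> (i, j) = (7, 4)"
    then have "d \<in> diag_dirs" using d by simp
    then show ?thesis using k loc(1) s(2) unfolding diag_dirs_def
      by (auto simp: jump_ok_def c content_def)
  next
    assume k: "k = Pawn \<and> (i, j) \<in> wall_squares"
    then have "d \<in> dirs_up" using d by simp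
    then show ?thesis using k loc(1) s(2)
      by (auto simp: jump_ok_def c content_def)
  qed
  then show "b (s \<oplus> d) \<noteq> None" "\<not> jump_ok b s d" by blast+
qed

lemma jump_ok_allowed: "jump_ok b s d \<Longrightarrow> b s = Some pc \<Longrightarrow> allowed pc d"
  by (auto simp: jump_ok_def)

lemma quiet_move_cases [consumes 2, case_names simple jumps infinite]:
  assumes q: "quiet b w" and m: "move (b, Black) (b', c)"
  obtains (simple) d k where "b w = Some (Black, k)" "allowed (Black, k) d" "b (w \<oplus> d) = None"
  | (jumps) bs ss ds n k where "n \<ge> 1" "bs 0 = b" "ss 0 = w" "b w = Some (Black, k)"
      "\<And>i. i < n \<Longrightarrow> jump_ok (bs i) (ss i) (ds i)"
      "\<And>i. i < n \<Longrightarrow> (bs (Suc i), ss (Suc i)) = jump_res (bs i) (ss i) (ds i)"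
      "b' = bs n" "c = Red"
  | (infinite) bs ss ds k where "bs 0 = b" "ss 0 = w" "b w = Some (Black, k)"
      "\<And>i. jump_ok (bs i) (ss i) (ds i)"
      "\<And>i. (bs (Suc i), ss (Suc i)) = jump_res (bs i) (ss i) (ds i)"
      "b' = (\<lambda>x. if x = w \<or> (\<exists>i. x = ss i \<oplus> ds i) then None else b x)" "c = Red"
  using m
proof (cases rule: move_cases)
  case (simple s d k)
  then have "s = w" using quiet_blocked(1)[OF q] by blast
  then show ?thesis using simple that(1) by blast
next
  case (jumps bs ss ds n k)
  then have j: "jump_ok b (ss 0) (ds 0)" by (metis One_nat_def Suc_le_lessD)
  then have "ss 0 = w" using quiet_blocked(2)[OF q _ jumps(3) jump_ok_allowed[OF j jumps(3)]] by blast
  then show ?thesis using jumps that(2)[of n bs ss k ds] by simp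
next
  case (infinite bs ss ds k)
  then have j: "jump_ok b (ss 0) (ds 0)" by metis
  then have "ss 0 = w" using quiet_blocked(2)[OF q _ infinite(2) jump_ok_allowed[OF j infinite(2)]] by blast
  then show ?thesis using infinite that(3)[of bs ss k ds] by simp
qed

lemma quiet_won:
  assumes "quiet b w" "\<not> black_at b w"
  shows "won (b, Black)"
proof (rule won_closed)
  fix q assume "move (b, Black) q"
  then have m: "move (b, Black) (fst q, snd q)" by simp
  show "won q" using assms(1) m by (cases rule: quiet_move_cases) (use assms(2) in auto)
qed simp

text \<open>The walker is the only mobile black piece, so once it is captured outside
  \<open>core\<close> Black has no move at all.\<close>

lemma capture_won:
  assumes q: "quiet b p" and p: "b p = Some (Black, Pawn)" and d: "d \<in> dirs_up"
    and r: "b (p \<oplus> d) = Some (Red, Pawn)" and t: "p = t \<oplus> d" "b t = None"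
    and nc: "\<not> core p" "\<not> core (p \<oplus> d)" "\<not> core t"
  shows "won (b, Red)"
proof -
  define e where "e = opposite d"
  have e: "e \<in> dirs_down" using d by (auto simp: e_def)
  have undo: "p \<oplus> d \<oplus> e = p" "p \<oplus> e = t" using t by (simp_all add: sq_add_def e_def)
  have j: "jump_ok b (p \<oplus> d) e" unfolding jump_ok_def undo using r p t(2) e by simp
  define b' where "b' = b(p \<oplus> d := None, p := None, t := Some (Red, Pawn))"
  have "jump_res b (p \<oplus> d) e = (b', t)" using r by (simp add: jump_res_def undo b'_def)
  then have "jump_seq (b, p \<oplus> d) (b', t)" using jump_one[OF j] by simp
  then have "move (b, Red) (b', Black)" using move_jump_seq[of b "p \<oplus> d" b' t Red Pawn] r by simp
  moreover have "quiet b' p" using q nc by (auto simp: quiet_def b'_def)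
  moreover have "\<not> black_at b' p" using t d by (auto simp: b'_def)
  ultimately show ?thesis using quiet_won won_open[of "(b, Red)"] by simp
qed

section \<open>Red's strategy against a walker on the lanes\<close>

definition strolling :: "int \<Rightarrow> board \<Rightarrow> square \<Rightarrow> bool" where
  "strolling c b w \<longleftrightarrow> walking door c b w \<and> spot w \<and> (\<forall>s. s \<noteq> w \<longrightarrow> black_at b s \<longrightarrow> b s = board0 s)"

lemma spot_lane: "spot w \<Longrightarrow> lane w"
  by (cases rule: spot.cases) (auto simp: lane_def)

lemma strolling_quiet: "strolling c b w \<Longrightarrow> quiet b w"
  unfolding quiet_def strolling_def walking_def
  using core_not_lane core_not_door spot_lane by metis

lemma strolling_hop:
  assumes s: "strolling c b w" and h: "hop w d"
  shows "strolling c (hop_board b w d) (w \<oplus> d \<oplus> d)" "snd (w \<oplus> d \<oplus> d) = snd w + 2"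
proof -
  note hw = hop_walking[where c = c and b = b, OF _ h door_not_lane]
  show "strolling c (hop_board b w d) (w \<oplus> d \<oplus> d)"
    using s hw hop_facts(8)[OF h] by (auto simp: strolling_def hop_board_def)
  show "snd (w \<oplus> d \<oplus> d) = snd w + 2" using s hw by (auto simp: strolling_def)
qed

lemma strolling_ahead:
  assumes "strolling c b w" "snd w < snd s" "\<not> door s \<or> c \<le> gate_height s"
  shows "b s = board0 s"
proof -
  have "s \<noteq> w" using assms(2) by auto
  then show ?thesis using assms unfolding strolling_def walking_def by (meson not_le)
qed

text \<open>The landing square is above the walker, so off the doors it must be empty on
  \<open>board0\<close> already, and only the ends of hops are. The exception is the room behind a
  door pawn that has moved to the entrance.\<close>

lemma strolling_jump:
  assumes s: "strolling c b w" and j: "jump_ok b w d"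
  shows "hop w d \<or> (\<exists>x y. w = loc x y 4 2 \<and> G x y \<and> d = (-1, 1) \<and> b (loc x y 4 3) = Some (Red, Pawn))"
proof -
  have w: "b w = Some (Black, Pawn)" and rp: "red_pawns b"
    using s by (auto simp: strolling_def walking_def)
  have d: "d = (1, 1) \<or> d = (-1, 1)" using jump_ok_allowed[OF j w] by simp
  have t: "b (w \<oplus> d \<oplus> d) = None" using j by (auto simp: jump_ok_def)
  have t0: "\<not> door (w \<oplus> d \<oplus> d) \<Longrightarrow> board0 (w \<oplus> d \<oplus> d) = None"
    using strolling_ahead[OF s, of "w \<oplus> d \<oplus> d"] t d snd_dirs_up[of d] by auto
  have "spot w" using s by (simp add: strolling_def)
  then show ?thesis
  proof cases
    case (spot_up j x y)
    show ?thesis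
      using d
    proof
      assume d: "d = (1, 1)"
      then have "R x y \<and> j = 0"
        using t0 spot_up by (auto simp: door_def content_def split: if_splits)
      then show ?thesis using hop_low[of x y 0] d spot_up by simp
    next
      assume d: "d = (-1, 1)"
      have "U x y"
      proof (cases "j = 0")
        case True
        then show ?thesis using t0 spot_up d by (auto simp: door_def content_def split: if_splits)
      qed (use spot_up in simp)
      then show ?thesis using hop_up spot_up d by simp
    qed
  next
    case (spot_low x y i)
    show ?thesis
      using d
    proof
      assume d: "d = (1, 1)"
      then have "i = 2"
        using t0 spot_low by (auto simp: door_def content_def split: if_splits)
      then show ?thesis using hop_low[of x y 2] d spot_low by simp
    next
      assume d: "d = (-1, 1)"
      then have "i = 4"
        using t0 spot_low by (auto simp: door_def content_def split: if_splits)
      then show ?thesis using hop_corner[of x y] d spot_low by simp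
    qed
  next
    case (spot_high x y i)
    show ?thesis
      using d
    proof
      assume d: "d = (1, 1)"
      then show ?thesis using hop_high spot_high by simp
    next
      assume d: "d = (-1, 1)"
      then have i: "i = 4 \<and> G x y"
        using t0 spot_high by (auto simp: door_def content_def split: if_splits)
      have "red_at b (loc x y 4 3)" using j d i spot_high w
        by (auto simp: jump_ok_def) (metis colour.exhaust prod.collapse)
      then show ?thesis using i d spot_high rp by (auto simp: red_pawns_def)
    qed
  qed
qed

text \<open>A door at height \<open>c\<close> or above is still open, so at such a gate there is no
  pawn on the entrance to jump over.\<close>

lemma strolling_jump_open:
  assumes s: "strolling c b w" and j: "jump_ok b w d" and c: "c \<le> snd w"
  shows "hop w d"
  using strolling_jump[OF s j]
proof
  assume "\<exists>x y. w = loc x y 4 2 \<and> G x y \<and> d = (-1, 1) \<and> b (loc x y 4 3) = Some (Red, Pawn)"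
  then obtain x y where w: "w = loc x y 4 2" "G x y" "b (loc x y 4 3) = Some (Red, Pawn)" by blast
  then have "b (loc x y 4 3) = board0 (loc x y 4 3)"
    using c by (intro strolling_ahead[OF s]) (simp_all add: snd_loc gate_height_def)
  then show ?thesis using w by (simp add: content_def)
qed

text \<open>Provides the pawn with which Red captures a walker that stops; at a gate the square
  beyond is the empty entrance instead.\<close>

lemma hop_beyond:
  assumes "hop p d" "\<nexists>x y. G x y \<and> p \<oplus> d \<oplus> d = loc x y 4 2"
  shows "board0 (p \<oplus> d \<oplus> d \<oplus> d) = Some (Red, Pawn)" "\<not> door (p \<oplus> d \<oplus> d \<oplus> d)"
    "\<not> core (p \<oplus> d \<oplus> d \<oplus> d)"
proof -
  have "board0 (p \<oplus> d \<oplus> d \<oplus> d) = Some (Red, Pawn) \<and> \<not> door (p \<oplus> d \<oplus> d \<oplus> d) \<and>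
    \<not> core (p \<oplus> d \<oplus> d \<oplus> d)"
    using assms(1)
  proof cases
    case (hop_up x y j)
    then have "j \<le> 12 \<or> j = 14" by presburger
    then show ?thesis
    proof
      assume "j = 14"
      then have "p \<oplus> d \<oplus> d = loc x (y + 1) 0 0" using hop_up by (simp add: loc_wrap)
      then show ?thesis using hop_up by (simp add: content_def door_def core_def)
    qed (use hop_up in \<open>auto simp: content_def door_def core_def\<close>)
  next
    case (hop_low x y i)
    then show ?thesis by (auto simp: content_def door_def core_def)
  next
    case (hop_corner x y)
    then have "\<not> G x y" using assms(2) by auto
    then show ?thesis using hop_corner by (simp add: content_def door_def core_def)
  next
    case (hop_high x y i)
    then have "i \<le> 12 \<or> i = 14" by presburger
    then show ?thesis
    proof
      assume "i = 14"
      then have "p \<oplus> d \<oplus> d = loc (x + 1) y 0 0" using hop_high by (simp add: loc_wrap)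
      then show ?thesis using hop_high by (simp add: content_def door_def core_def)
    qed (use hop_high in \<open>auto simp: content_def door_def core_def\<close>)
  qed
  then show "board0 (p \<oplus> d \<oplus> d \<oplus> d) = Some (Red, Pawn)" "\<not> door (p \<oplus> d \<oplus> d \<oplus> d)"
    "\<not> core (p \<oplus> d \<oplus> d \<oplus> d)" by blast+
qed

text \<open>Away from a gate, the walker has just vacated a square into which Red can capture it.\<close>
lemma stop_won:
  assumes s: "strolling c b q" and h: "hop p d" "q = p \<oplus> d \<oplus> d" "b (p \<oplus> d) = None"
    and ng: "\<nexists>x y. G x y \<and> q = loc x y 4 2"
  shows "won (b, Red)"
proof (rule capture_won[OF strolling_quiet[OF s]])
  show "b q = Some (Black, Pawn)" using s by (simp add: strolling_def walking_def)
  show "d \<in> dirs_up" using hop_facts[OF h(1)] by simp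
  then have "snd q < snd (q \<oplus> d)" by (simp add: snd_dirs_up)
  note hb = hop_beyond[OF h(1) ng[unfolded h(2)], folded h(2)]
  show "b (q \<oplus> d) = Some (Red, Pawn)"
    using strolling_ahead[OF s \<open>snd q < snd (q \<oplus> d)\<close>] hb by simp
  show "q = p \<oplus> d \<oplus> d" "b (p \<oplus> d) = None" by (rule h)+
  show "\<not> core q" "\<not> core (p \<oplus> d)" using hop_facts(3,4)[OF h(1)] core_not_lane h(2) by blast+
  show "\<not> core (q \<oplus> d)" by (rule hb)
qed

text \<open>Pawns on both squares above exclude simple moves of the walker. They lie outside
  \<open>core\<close>, so Red may later spend one on a waiting move.\<close>

definition resting :: "int \<Rightarrow> board \<Rightarrow> square \<Rightarrow> bool" where
  "resting c b w \<longleftrightarrow> strolling c b w \<and> c \<le> snd w + 1 \<and>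
     (\<forall>d\<in>dirs_up. b (w \<oplus> d) = Some (Red, Pawn) \<and> \<not> core (w \<oplus> d))"

text \<open>With the door pawn on \<open>(4,3)\<close> and the lane pawn on \<open>(5,2)\<close> the
  walker is hemmed in again, and the raised bound accounts for this door.\<close>

lemma close_door:
  assumes s: "strolling c b w" and w: "w = loc x y 4 2" and g: "G x y" and c: "c \<le> snd w"
  defines "b' \<equiv> b(loc x y 5 3 := None, loc x y 4 3 := Some (Red, Pawn))"
  shows "move (b, Red) (b', Black)" "resting (snd w + 1) b' w"
proof -
  have ah: "b (loc x y i j) = content (U x y) True True i j"
    if "0 \<le> i" "i < 16" "0 \<le> j" "j < 16" "6 < i + j" for i j
    using strolling_ahead[OF s, of "loc x y i j"] that c w g G_R[OF g]
    by (simp add: snd_loc gate_height_def)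
  have v: "b (loc x y 5 3) = Some (Red, Pawn)" "b (loc x y 4 3) = None" "b (loc x y 5 2) = Some (Red, Pawn)"
    by (simp_all add: ah content_def)
  show "move (b, Red) (b', Black)"
    using move_simple[of b "loc x y 5 3" Red Pawn "(-1,-1)"] v by (simp add: b'_def)
  have sp: "walking door c b w" "spot w" "\<forall>s. s \<noteq> w \<longrightarrow> black_at b s \<longrightarrow> b s = board0 s"
    using s by (auto simp: strolling_def)
  have "red_pawns b'" using sp(1) by (auto simp: walking_def red_pawns_def b'_def)
  moreover have "b' w = Some (Black, Pawn)" using sp(1) w by (auto simp: walking_def b'_def)
  moreover have "lane s \<and> snd s \<le> snd w \<or> door s \<and> gate_height s < snd w + 1"
    if "s \<noteq> w" "b' s \<noteq> board0 s" for s
  proof (cases "s = loc x y 5 3 \<or> s = loc x y 4 3")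
    case True
    then show ?thesis using g w by (auto simp: door_def gate_height_def snd_loc)
  next
    case False
    then have "b s \<noteq> board0 s" using that by (simp add: b'_def)
    then show ?thesis using sp(1) that(1) c unfolding walking_def by force
  qed
  ultimately have "walking door (snd w + 1) b' w" by (simp add: walking_def)
  then show "resting (snd w + 1) b' w"
    using sp v w by (simp add: resting_def strolling_def b'_def core_def)
qed

text \<open>Jumping over a closed door leads to \<open>(4,4)\<close>. Both further landing squares
  are occupied, and the pawn on \<open>(4,5)\<close> captures the walker into the
  \<open>(4,3)\<close> it has just cleared.\<close>

lemma dead_end:
  assumes s: "strolling c b w" and w: "w = loc x y 4 2" and g: "G x y"
    and r: "b (loc x y 4 3) = Some (Red, Pawn)"
  defines "b' \<equiv> hop_board b w (-1, 1)"
  shows "won (b', Red)" "\<not> jump_ok b' (loc x y 4 4) d"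
proof -
  have ah: "b (loc x y i j) = content (U x y) True True i j"
    if "0 \<le> i" "i < 16" "0 \<le> j" "j < 16" "6 < i + j" "j \<noteq> 3" for i j
    using strolling_ahead[OF s, of "loc x y i j"] that w g G_R[OF g]
    by (simp add: snd_loc door_def)
  have b': "b' = b(w := None, loc x y 4 3 := None, loc x y 4 4 := Some (Black, Pawn))"
    using s by (simp add: b'_def hop_board_def w strolling_def walking_def)
  have v: "b (loc x y 4 5) = Some (Red, Pawn)" "b (loc x y 4 6) = Some (Red, Pawn)"
    "b (loc x y 5 4) = Some (Red, Pawn)" "b (loc x y 6 4) = Some (Red, Pawn)"
    by (simp_all add: ah content_def)
  have "quiet b w" using s by (rule strolling_quiet)
  moreover have nc: "\<not> core w" "\<not> core (loc x y 4 3)" "\<not> core (loc x y 4 4)" "\<not> core (loc x y 4 5)"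
    by (simp_all add: core_def w)
  ultimately have "quiet b' (loc x y 4 4)"
    unfolding quiet_def b' by auto
  then show "won (b', Red)"
    by (rule capture_won[where d = "(-1,1)" and t = "loc x y 4 3"]) (use v nc in \<open>simp_all add: b' w\<close>)
  show "\<not> jump_ok b' (loc x y 4 4) d"
  proof
    assume j: "jump_ok b' (loc x y 4 4) d"
    have "b' (loc x y 4 4) = Some (Black, Pawn)" by (simp add: b')
    then have "d = (1,1) \<or> d = (-1,1)" using jump_ok_allowed[OF j] by simp
    moreover have "b' (loc x y 4 4 \<oplus> d \<oplus> d) = None" using j by (auto simp: jump_ok_def)
    ultimately show False using v by (elim disjE) (simp_all add: b' w)
  qed
qed

end

context labelled_tracks
begin

text \<open>The label is constant along lanes by \<open>label_U\<close> and \<open>label_R\<close>;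
  \<open>label_G\<close> applies at the hop from \<open>(4,0)\<close> to
  \<open>(4,2)\<close>.\<close>

lemma hop_label:
  assumes "hop w d"
  shows "label (w \<oplus> d \<oplus> d) \<le> label w"
    "G x y \<Longrightarrow> w \<oplus> d \<oplus> d = loc x y 4 2 \<Longrightarrow> label (w \<oplus> d \<oplus> d) < label w"
proof -
  have "label (w \<oplus> d \<oplus> d) \<le> label w \<and>
    (cell_i (w \<oplus> d \<oplus> d) = 4 \<and> cell_j (w \<oplus> d \<oplus> d) = 2 \<and>
      G (cell_x (w \<oplus> d \<oplus> d)) (cell_y (w \<oplus> d \<oplus> d)) \<longrightarrow> label (w \<oplus> d \<oplus> d) < label w)"
    using assms
  proof cases
    case (hop_up x y j)
    then have "j \<le> 12 \<or> j = 14" by presburger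
    then show ?thesis
    proof
      assume "j = 14"
      then have "w \<oplus> d \<oplus> d = loc x (y + 1) 0 0" using hop_up by (simp add: loc_wrap)
      then show ?thesis using hop_up label_U[of x y] by (simp add: label_def)
    qed (use hop_up in \<open>auto simp: label_def add.assoc\<close>)
  next
    case (hop_low x y i)
    then show ?thesis by (auto simp: label_def)
  next
    case (hop_corner x y)
    then show ?thesis using label_G[of x y] label_R[of x y] by (cases "G x y") (auto simp: label_def)
  next
    case (hop_high x y i)
    then have "i \<le> 12 \<or> i = 14" by presburger
    then show ?thesis
    proof
      assume "i = 14"
      then have "w \<oplus> d \<oplus> d = loc (x + 1) y 0 0" using hop_high by (simp add: loc_wrap)
      then show ?thesis using hop_high by (simp add: label_def)
    qed (use hop_high in \<open>auto simp: label_def add.assoc\<close>)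
  qed
  then show "label (w \<oplus> d \<oplus> d) \<le> label w"
    "G x y \<Longrightarrow> w \<oplus> d \<oplus> d = loc x y 4 2 \<Longrightarrow> label (w \<oplus> d \<oplus> d) < label w" by auto
qed

text \<open>Invariant inside an iterated jump begun at label \<open>a\<close>. The strict bound at
  gates feeds the induction on labels; the last conjunct supplies the square into which Red
  captures.\<close>

definition arrived :: "int \<Rightarrow> 'o \<Rightarrow> board \<Rightarrow> square \<Rightarrow> bool" where
  "arrived c a b q \<longleftrightarrow> strolling c b q \<and> c \<le> snd q \<and> label q \<le> a \<and>
     (\<forall>x y. G x y \<longrightarrow> q = loc x y 4 2 \<longrightarrow> label q < a) \<and>
     (\<exists>p d. hop p d \<and> q = p \<oplus> d \<oplus> d \<and> b (p \<oplus> d) = None)"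

lemma arrived_hop:
  assumes "strolling c b w" "c \<le> snd w + 1" "label w \<le> a" "hop w d"
  shows "arrived c a (hop_board b w d) (w \<oplus> d \<oplus> d)"
proof -
  have "hop_board b w d (w \<oplus> d) = None" using hop_facts(1)[OF assms(4)] by (auto simp: hop_board_def)
  moreover have "\<forall>x y. G x y \<longrightarrow> w \<oplus> d \<oplus> d = loc x y 4 2 \<longrightarrow> label (w \<oplus> d \<oplus> d) < a"
    using hop_label(2)[OF assms(4)] assms(3) by (meson less_le_trans)
  ultimately show ?thesis
    unfolding arrived_def using strolling_hop[OF assms(1,4)] assms hop_label(1)[OF assms(4)]
    by (intro conjI) (auto intro: order_trans)
qed

lemma arrived_jump:
  assumes a: "arrived c a b q" and j: "jump_ok b q d"
  shows "hop q d" "arrived c a (hop_board b q d) (q \<oplus> d \<oplus> d)"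
proof -
  show h: "hop q d" using a strolling_jump_open[OF _ j] by (auto simp: arrived_def)
  show "arrived c a (hop_board b q d) (q \<oplus> d \<oplus> d)"
    using a arrived_hop[OF _ _ _ h, of c b a] by (simp add: arrived_def)
qed

lemma arrived_won:
  assumes a: "arrived c a b q"
    and IH: "\<And>c b w. resting c b w \<Longrightarrow> label w < a \<Longrightarrow> won (b, Black)"
  shows "won (b, Red)"
proof (cases "\<exists>x y. G x y \<and> q = loc x y 4 2")
  case True
  then obtain x y where xy: "G x y" "q = loc x y 4 2" by blast
  then have l: "label q < a" and s: "strolling c b q" "c \<le> snd q" using a by (auto simp: arrived_def)
  note cd = close_door[OF s(1) xy(2,1) s(2)]
  show ?thesis using won_open[OF _ cd(1)] IH[OF cd(2) l] by simp
next
  case False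
  then show ?thesis using a stop_won unfolding arrived_def by blast
qed

text \<open>A walker that stops at a new gate has a smaller label and is shut out there; one that
  stops elsewhere or jumps over a closed door is captured; one that never stops removes
  itself.\<close>

lemma resting_won:
  assumes "resting c b w"
  shows "won (b, Black)"
  using assms
proof (induction "label w" arbitrary: b w c rule: less_induct)
  case less
  have s: "strolling c b w" and c: "c \<le> snd w + 1"
    and st: "\<And>d. d \<in> dirs_up \<Longrightarrow> b (w \<oplus> d) = Some (Red, Pawn) \<and> \<not> core (w \<oplus> d)"
    using less.prems by (auto simp: resting_def)
  have w: "b w = Some (Black, Pawn)" using s by (simp add: strolling_def walking_def)
  note quiet = strolling_quiet[OF s]
  show ?case
  proof (rule won_closed)
    fix q assume "move (b, Black) q"
    then obtain b' c' where q: "q = (b', c')" and m: "move (b, Black) (b', c')" by (metis surj_pair)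
    have "won (b', c')"
      using quiet m
    proof (cases rule: quiet_move_cases)
      case (simple d k)
      then show ?thesis using w st[of d] by auto
    next
      case (jumps bs ss ds n k)
      have step: "bs (Suc i) = hop_board (bs i) (ss i) (ds i)" "ss (Suc i) = ss i \<oplus> ds i \<oplus> ds i" if "i < n" for i
        using jumps(6)[OF that] by (simp_all add: jump_res_hop)
      have j0: "jump_ok b w (ds 0)" using jumps(1,2,3) jumps(5)[of 0] by simp
      have one: "bs 1 = hop_board b w (ds 0)" "ss 1 = w \<oplus> ds 0 \<oplus> ds 0"
        using step[of 0] jumps(1,2,3) by simp_all
      from strolling_jump[OF s j0] show ?thesis
      proof
        assume h: "hop w (ds 0)"
        have "arrived c (label w) (bs (Suc i)) (ss (Suc i))" if "Suc i \<le> n" for i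
          using that
        proof (induction i)
          case 0
          then show ?case using arrived_hop[OF s c order_refl h] one by simp
        next
          case (Suc i)
          then show ?case using arrived_jump(2)[OF _ jumps(5)[of "Suc i"]] step[of "Suc i"] by simp
        qed
        from this[of "n - 1"] have "arrived c (label w) (bs n) (ss n)" using jumps(1) by simp
        then show ?thesis using arrived_won less.hyps jumps(7,8) by blast
      next
        assume "\<exists>x y. w = loc x y 4 2 \<and> G x y \<and> ds 0 = (-1, 1) \<and> b (loc x y 4 3) = Some (Red, Pawn)"
        then obtain x y where xy: "w = loc x y 4 2" "G x y" "ds 0 = (-1, 1)"
          "b (loc x y 4 3) = Some (Red, Pawn)" by blast
        note de = dead_end[OF s xy(1,2,4)]
        have "\<not> 1 < n" using jumps(5)[of 1] de(2)[of "ds 1"] one xy by auto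
        then have "n = 1" using jumps(1) by simp
        then show ?thesis using de(1) jumps(7,8) one xy(3) by simp
      qed
    next
      case (infinite bs ss ds k)
      have step: "bs (Suc i) = hop_board (bs i) (ss i) (ds i)" "ss (Suc i) = ss i \<oplus> ds i \<oplus> ds i" for i
        using infinite(5)[of i] by (simp_all add: jump_res_hop)
      have one: "bs 1 = hop_board b w (ds 0)" "ss 1 = w \<oplus> ds 0 \<oplus> ds 0"
        using step[of 0] infinite(1,2) by simp_all
      have j0: "jump_ok b w (ds 0)" using infinite(4)[of 0] infinite(1,2) by simp
      have h: "hop w (ds 0)"
        using strolling_jump[OF s j0]
      proof
        assume "\<exists>x y. w = loc x y 4 2 \<and> G x y \<and> ds 0 = (-1, 1) \<and> b (loc x y 4 3) = Some (Red, Pawn)"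
        then obtain x y where xy: "w = loc x y 4 2" "G x y" "ds 0 = (-1, 1)"
          "b (loc x y 4 3) = Some (Red, Pawn)" by blast
        show ?thesis using infinite(4)[of 1] dead_end(2)[OF s xy(1,2,4), of "ds 1"] one xy by auto
      qed
      have ar: "arrived c (label w) (bs (Suc i)) (ss (Suc i))" for i
      proof (induction i)
        case 0
        then show ?case using arrived_hop[OF s c order_refl h] one by simp
      next
        case (Suc i)
        then show ?case using arrived_jump(2)[OF _ infinite(4)[of "Suc i"]] step[of "Suc i"] by simp
      qed
      have hops: "hop (ss i) (ds i)" for i
        using h infinite(2) arrived_jump(1)[OF ar infinite(4)] by (cases i) auto
      have nc: "\<not> core w" "\<not> core (ss i \<oplus> ds i)" for i
        using hop_facts(2)[OF h] hop_facts(3)[OF hops] core_not_lane by blast+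
      have h0: "ds 0 = (1, 1) \<or> ds 0 = (-1, 1)" using hop_facts(1)[OF h] by simp
      \<comment> \<open>After an endless jump Red still needs a harmless move: the pawn on the side
        not taken by the first jump steps onto the vacated \<open>w\<close>.\<close>
      define e :: square where "e = (if ds 0 = (1, 1) then (-1, 1) else (1, 1))"
      have e: "e \<in> dirs_up" "ds 0 \<noteq> e" using h0 by (auto simp: e_def)
      have "w \<oplus> e \<noteq> ss i \<oplus> ds i" for i
      proof (cases i)
        case 0
        then show ?thesis using infinite(2) e by simp
      next
        case (Suc j)
        \<comment> \<open>The jumped pieces have heights \<open>snd w + 2 * i + 1\<close>, so only
          the first is as low as \<open>w \<oplus> e\<close>, and it lies on the other side.\<close>
        have "snd (ss (Suc k)) = snd w + 2 * int (Suc k)" for k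
        proof (induction k)
          case 0
          then show ?case using one snd_dirs_up[OF hop_facts(1)[OF h]] by simp
        next
          case (Suc k)
          then show ?case using step[of "Suc k"] snd_dirs_up[OF hop_facts(1)[OF hops[of "Suc k"]]] by simp
        qed
        then have "snd (ss i \<oplus> ds i) = snd w + 2 * int i + 1"
          using snd_dirs_up[OF hop_facts(1)[OF hops[of i]]] Suc by simp
        then have "snd (ss i \<oplus> ds i) \<noteq> snd (w \<oplus> e)" using snd_dirs_up[OF e(1)] Suc by simp
        then show ?thesis by auto
      qed
      then have r: "b' (w \<oplus> e) = Some (Red, Pawn)"
        using st[OF e(1)] e(1) by (auto simp: infinite(6))
      have undo: "w \<oplus> e \<oplus> opposite e = w" by (simp add: sq_add_def)
      have "opposite e \<in> dirs_down" using e(1) by auto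
      then have mv: "move (b', Red) (b'(w \<oplus> e := None, w := Some (Red, Pawn)), Black)"
        using move_simple[of b' "w \<oplus> e" Red Pawn "opposite e"] r unfolding undo
        by (simp add: infinite(6))
      have "quiet (b'(w \<oplus> e := None, w := Some (Red, Pawn))) w"
        using quiet nc st[OF e(1)] unfolding infinite(6) quiet_def by auto
      then have "won (b'(w \<oplus> e := None, w := Some (Red, Pawn)), Black)"
        by (rule quiet_won) simp
      then show ?thesis using won_open[OF _ mv] infinite(7) by simp
    qed
    then show "won q" by (simp add: q)
  qed simp
qed

lemma start_position:
  "\<exists>p. valid_pos p \<and> won p \<and> (\<forall>\<gamma><lab 0 0. \<not> val_le p \<gamma>)"
proof -
  define w where "w = loc 0 0 0 0"
  define b where "b = board0(w := Some (Black, Pawn))"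
  \<comment> \<open>The board differs from \<open>board0\<close> at \<open>w\<close> only, so the
    invariants of Black and of Red hold alike, with any bound.\<close>
  have wk: "walking Z 0 b w" for Z
    using red_pawns_board0 by (auto simp: walking_def b_def red_pawns_def)
  have "spot w" using spot_up[of 0 0 0] by (simp add: w_def)
  then have "resting 0 b w"
    using wk by (simp add: resting_def strolling_def b_def w_def snd_loc content_def core_def)
  then have "won (b, Black)" by (rule resting_won)
  moreover have "valid_pos (b, Black)" by (auto simp: valid_pos_def b_def w_def board0_def)
  moreover have "label w = lab 0 0" by (simp add: label_def w_def)
  then have "\<forall>\<gamma><lab 0 0. \<not> val_le (b, Black) \<gamma>"
    using value_ge_label[OF wk] by (simp add: at_rest_def w_def snd_loc)
  ultimately show ?thesis by blast
qed

end

section \<open>The tree\<close>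

text \<open>The lines of a growing planar tree: at stage \<open>n\<close> the lines \<open>0, \<dots>, n\<close> occupy the
  positions \<open>0, \<dots>, n\<close>, and line \<open>n + 1\<close> is inserted right after its parent \<open>p n\<close>.\<close>
locale growth =
  fixes p :: "nat \<Rightarrow> nat"
  assumes p_le: "p n \<le> n"
begin

fun line_at :: "nat \<Rightarrow> nat \<Rightarrow> nat" where
  "line_at 0 x = 0"
| "line_at (Suc n) x = (let k = (SOME k. k \<le> n \<and> line_at n k = p n) in
     if x \<le> k then line_at n x else if x = Suc k then Suc n else line_at n (x - 1))"

text \<open>Repeats the choice made inside \<open>line_at\<close>, giving a name to the position of
  the parent at stage \<open>n\<close>.\<close>

definition fork :: "nat \<Rightarrow> nat" where
  "fork n = (SOME k. k \<le> n \<and> line_at n k = p n)"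

lemma line_at_Suc: "line_at (Suc n) x =
  (if x \<le> fork n then line_at n x else if x = Suc (fork n) then Suc n else line_at n (x - 1))"
  by (simp add: fork_def Let_def)

declare line_at.simps(2) [simp del]

text \<open>Surjectivity and the existence of the fork are proved together: the parent
  \<open>p n \<le> n\<close> has a position because all lines up to \<open>n\<close> occur.
  Injectivity follows by counting.\<close>

lemma line_at_bij: "bij_betw (line_at n) {..n} {..n}" and fork: "fork n \<le> n" "line_at n (fork n) = p n"
proof -
  have *: "line_at n ` {..n} = {..n} \<and> fork n \<le> n \<and> line_at n (fork n) = p n" for n
  proof (induction n)
    case 0
    have "\<exists>k\<le>0. line_at 0 k = p 0" using p_le[of 0] by simp
    then show ?case using someI_ex[of "\<lambda>k. k \<le> 0 \<and> line_at 0 k = p 0"] by (simp add: fork_def)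
  next
    case (Suc n)
    then have f: "fork n \<le> n" and im: "line_at n ` {..n} = {..n}" by auto
    have "line_at (Suc n) ` {..Suc n} = {..Suc n}"
    proof (intro set_eqI iffI)
      fix i assume "i \<in> line_at (Suc n) ` {..Suc n}"
      then obtain x where x: "x \<le> Suc n" "i = line_at (Suc n) x" by auto
      have "line_at n y \<le> n" if "y \<le> n" for y using im that by auto
      then show "i \<in> {..Suc n}" using x f by (auto simp: line_at_Suc le_SucI)
    next
      fix i assume i: "i \<in> {..Suc n}"
      show "i \<in> line_at (Suc n) ` {..Suc n}"
      proof (cases "i = Suc n")
        case True
        then show ?thesis using f by (intro image_eqI[of _ _ "Suc (fork n)"]) (auto simp: line_at_Suc)
      next
        case False
        then have "i \<in> line_at n ` {..n}" using i im by auto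
        then obtain x where x: "x \<le> n" "i = line_at n x" by auto
        show ?thesis
        proof (cases "x \<le> fork n")
          case True
          then show ?thesis using x by (intro image_eqI[of _ _ x]) (auto simp: line_at_Suc)
        next
          case False
          then show ?thesis using x by (intro image_eqI[of _ _ "Suc x"]) (auto simp: line_at_Suc)
        qed
      qed
    qed
    moreover from this have "\<exists>k\<le>Suc n. line_at (Suc n) k = p (Suc n)"
      using p_le[of "Suc n"] by (metis atMost_iff imageE)
    then have "fork (Suc n) \<le> Suc n \<and> line_at (Suc n) (fork (Suc n)) = p (Suc n)"
      using someI_ex[of "\<lambda>k. k \<le> Suc n \<and> line_at (Suc n) k = p (Suc n)"] by (simp add: fork_def)
    ultimately show ?case by blast
  qed
  then show "bij_betw (line_at n) {..n} {..n}"
    by (simp add: bij_betw_def eq_card_imp_inj_on)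
  show "fork n \<le> n" "line_at n (fork n) = p n" using * by blast+
qed

lemma line_at_up: "x \<le> fork n \<Longrightarrow> line_at (Suc n) x = line_at n x"
  and line_at_child: "line_at (Suc n) (Suc (fork n)) = Suc n"
  and line_at_right: "fork n < x \<Longrightarrow> line_at (Suc n) (Suc x) = line_at n x"
  by (auto simp: line_at_Suc)

end

section \<open>Labels and tracks for a given countable ordinal\<close>

theorem theorem3:
  fixes \<alpha> :: "'o::wellorder"
  assumes "countable {\<beta>. \<beta> < \<alpha>}"
  shows "\<exists>p. valid_pos p \<and> has_value p \<alpha>"
proof -
  define f where "f = from_nat_into {\<beta>. \<beta> < \<alpha>}"
  \<comment> \<open>Decoding yields every number infinitely often, so each line keeps receiving
    children.\<close>
  define p where "p n = fst (prod_decode n)" for n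
  \<comment> \<open>Line \<open>0\<close> carries \<open>\<alpha>\<close>; the other labels come
    from the enumeration \<open>f\<close>. The minimum keeps them at most \<open>\<alpha>\<close>
    even when no ordinal lies below \<open>\<alpha>\<close> and \<open>f\<close> takes an arbitrary
    value.\<close>
  define l where "l i = (case i of 0 \<Rightarrow> \<alpha> | Suc n \<Rightarrow> min \<alpha> (f (fst (prod_decode (snd (prod_decode n))))))" for i
  \<comment> \<open>A child whose label is not smaller than its parent's is inserted without a gate
    or an edge leading to it.\<close>
  define live where "live n \<longleftrightarrow> l (Suc n) < l (p n)" for n
  interpret growth p
  proof
    show "p n \<le> n" for n
      using le_prod_encode_1[of "fst (prod_decode n)" "snd (prod_decode n)"] by (simp add: p_def)
  qed
  have enum: "\<exists>m\<ge>n. p m = i \<and> live m \<and> l (Suc m) = \<beta>" if "\<beta> < l i" for n i \<beta>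
  proof -
    have "l i \<le> \<alpha>" by (auto simp: l_def split: nat.split)
    then have \<beta>: "\<beta> < \<alpha>" using that by (rule less_le_trans[rotated])
    then obtain k where k: "f k = \<beta>" using from_nat_into_surj[OF assms] unfolding f_def by blast
    \<comment> \<open>The component \<open>i\<close> fixes the parent and \<open>k\<close> the
      label; \<open>n\<close> is padding that makes the stage late enough.\<close>
    define m where "m = prod_encode (i, prod_encode (k, n))"
    have "n \<le> m" using le_prod_encode_2[of n k] le_prod_encode_2[of "prod_encode (k, n)" i]
      by (simp add: m_def)
    then show ?thesis using that k \<beta>
      by (intro exI[of _ m]) (simp add: m_def p_def live_def, simp add: l_def)
  qed
  \<comment> \<open>Cell \<open>(x, y)\<close> carries the line at position \<open>x\<close> of
    stage \<open>x + y\<close>. Up to the fork a line keeps its position and goes up; beyond it the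
    insertion shifts the line, which goes right. At the fork itself the step right leads to a live
    child.\<close>
  define U :: "int \<Rightarrow> int \<Rightarrow> bool" where
    "U x y \<longleftrightarrow> 0 \<le> x \<and> 0 \<le> y \<and> nat x \<le> fork (nat x + nat y)" for x y
  define G :: "int \<Rightarrow> int \<Rightarrow> bool" where
    "G x y \<longleftrightarrow> 0 \<le> x \<and> 0 \<le> y \<and> nat x = fork (nat x + nat y) \<and> live (nat x + nat y)" for x y
  define R :: "int \<Rightarrow> int \<Rightarrow> bool" where
    "R x y \<longleftrightarrow> 0 \<le> x \<and> 0 \<le> y \<and> fork (nat x + nat y) < nat x \<or> G x y" for x y
  define lab :: "int \<Rightarrow> int \<Rightarrow> 'o" where "lab x y = l (line_at (nat x + nat y) (nat x))" for x y
  define edge where "edge = (\<lambda>(x, y) (x', y'). x' = x \<and> y' = y + 1 \<and> U x y \<or> x' = x + 1 \<and> y' = y \<and> R x y)"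
  have child: "lab (x + 1) y = l (Suc (nat x + nat y))" "lab x y = l (p (nat x + nat y))" if "G x y" for x y
  proof -
    have x: "nat (x + 1) = Suc (nat x)" "nat x = fork (nat x + nat y)" using that by (auto simp: G_def)
    then show "lab (x + 1) y = l (Suc (nat x + nat y))" "lab x y = l (p (nat x + nat y))"
      using line_at_child[of "nat x + nat y"] fork(2)[of "nat x + nat y"] by (auto simp: lab_def)
  qed
  have follow: "\<exists>x' y'. edge\<^sup>*\<^sup>* (int x, int y) (int x', int y') \<and> x' + y' = x + y + m \<and>
      line_at (x' + y') x' = line_at (x + y) x" for x y m :: nat
  proof (induction m)
    case 0
    then show ?case by auto
  next
    case (Suc m)
    then obtain x' y' where IH: "edge\<^sup>*\<^sup>* (int x, int y) (int x', int y')" "x' + y' = x + y + m"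
      "line_at (x' + y') x' = line_at (x + y) x" by blast
    show ?case
    proof (cases "x' \<le> fork (x' + y')")
      case True
      then have "edge (int x', int y') (int x', int (Suc y'))" by (simp add: edge_def U_def)
      then show ?thesis using IH True line_at_up[of x' "x' + y'"]
        by (intro exI[of _ x'] exI[of _ "Suc y'"]) (auto intro: rtranclp.rtrancl_into_rtrancl)
    next
      case False
      then have "edge (int x', int y') (int (Suc x'), int y')" by (simp add: edge_def R_def)
      then show ?thesis using IH False line_at_right[of "x' + y'" x']
        by (intro exI[of _ "Suc x'"] exI[of _ y']) (auto intro: rtranclp.rtrancl_into_rtrancl)
    qed
  qed
  interpret labelled_tracks U R G lab
  proof
    show "R x y" if "G x y" for x y using that by (simp add: R_def)
    show "lab x (y + 1) = lab x y" if "U x y" for x y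
      using that line_at_up[of "nat x" "nat x + nat y"] by (auto simp: U_def lab_def nat_add_distrib)
    show "lab (x + 1) y = lab x y" if "R x y" "\<not> G x y" for x y
      using that line_at_right[of "nat x + nat y" "nat x"] by (auto simp: R_def lab_def nat_add_distrib)
    show "lab (x + 1) y < lab x y" if "G x y" for x y
      using child[OF that] that by (simp add: G_def live_def)
    show "0 \<le> x \<and> 0 \<le> y" if "G x y" for x y using that by (simp add: G_def)
    show "\<exists>x' y'. (\<lambda>(x, y) (x', y'). x' = x \<and> y' = y + 1 \<and> U x y \<or> x' = x + 1 \<and> y' = y \<and> R x y)\<^sup>*\<^sup>*
        (x, y) (x', y') \<and> G x' y' \<and> lab (x' + 1) y' = \<beta>"
      if xy: "0 \<le> x" "0 \<le> y" "\<beta> < lab x y" for x y \<beta>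
    proof -
      let ?n = "nat x + nat y"
      obtain m where m: "?n \<le> m" "p m = line_at ?n (nat x)" "live m" "l (Suc m) = \<beta>"
        using enum[of \<beta> "line_at ?n (nat x)" ?n] xy(3) unfolding lab_def by blast
      obtain x' y' where f: "edge\<^sup>*\<^sup>* (int (nat x), int (nat y)) (int x', int y')" "x' + y' = m"
        "line_at m x' = line_at ?n (nat x)"
        using follow[of "nat x" "nat y" "m - ?n"] m(1) by auto
      \<comment> \<open>The followed line is the parent at stage \<open>m\<close>, so by injectivity
        it stands at the fork, where the gate is.\<close>
      have "line_at m x' = line_at m (fork m)" using f(3) m(2) fork(2)[of m] by simp
      moreover have "inj_on (line_at m) {..m}" using line_at_bij[of m] by (simp add: bij_betw_def)
      ultimately have "x' = fork m" using f(2) fork(1)[of m] by (auto dest: inj_onD)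
      then have g: "G (int x') (int y')" using f(2) m(3) by (simp add: G_def)
      have "lab (int x' + 1) (int y') = \<beta>" using child(1)[OF g] f(2) m(4) by simp
      then show ?thesis using f(1) g xy(1,2) unfolding edge_def by auto
    qed
  qed
  have "lab 0 0 = \<alpha>" by (simp add: lab_def l_def)
  then show ?thesis using start_position won_attains by metis
qed

end
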